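(* Let $k\ge 1$ be an integer. In the message-passing model with $s$ players and edge duplication allowed, the communication cost of computing a multiplicative $(2k-1)$-spanner of an $n$-vertex input graph is $\tilde O(s n^{1+1/k})$ bits. Moreover, assuming Erd\H{o}s' girth conjecture, this is tight: the cost is $\tilde\Theta(s n^{1+1/k})$.
   Context: Message-passing model: there are $s$ players $P^1,\dots,P^s$ and a coordinator. All parties know the vertex set $V$, $|V|=n$; player $P^i$ holds an edge set $E_i$ on $V$, and the input graph is $G=(V,\bigcup_i E_i)$ (unweighted, undirected). Communication is only between the coordinator and individual players; the coordinator must output the spanner. Communication cost is the total number of bits exchanged; randomized protocols must succeed with probability at least $2/3$ on every input. "With duplication" means the $E_i$ may overlap. A multiplicative $\alpha$-spanner of $G$ is a subgraph $H$ with $d_H(u,v)\le \alpha\, d_G(u,v)$ for all $u,v$. Erd\H{o}s' girth conjecture: for every integer $k\ge1$ and every $n$ there is an $n$-vertex graph with $\Omega(n^{1+1/k})$ edges and girth $2k+2$. $\tilde O,\tilde\Theta$ hide $\mathrm{poly}(\log n)$ factors. Standing assumption: $s\ll n$. *)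

theory Defs
  imports "HOL-Probability.Probability" "HOL-Library.Landau_Symbols"
begin

text \<open>
  A simple undirected graph on the vertex set \<open>{..<n}\<close> is given by its set of edges,
  a subset of \<open>all_edges n\<close>.
\<close>

type_synonym edges = "nat set set"

definition all_edges :: "nat \<Rightarrow> edges" where
  "all_edges n = {e. e \<subseteq> {..<n} \<and> card e = 2}"

text \<open>Infima over \<open>enat\<close>: the distance of disconnected vertices and the girth of a forest are \<open>\<infinity>\<close>.\<close>

definition walk :: "edges \<Rightarrow> nat \<Rightarrow> nat \<Rightarrow> nat list \<Rightarrow> bool" where
  "walk E u v p \<longleftrightarrow>
     p \<noteq> [] \<and> hd p = u \<and> last p = v \<and> successively (\<lambda>x y. {x, y} \<in> E) p"

definition graph_dist :: "edges \<Rightarrow> nat \<Rightarrow> nat \<Rightarrow> enat" where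
  "graph_dist E u v = (INF p\<in>{p. walk E u v p}. enat (length p - 1))"

definition cycle :: "edges \<Rightarrow> nat list \<Rightarrow> bool" where
  "cycle E p \<longleftrightarrow>
     length p \<ge> 3 \<and> distinct p \<and> successively (\<lambda>x y. {x, y} \<in> E) p \<and> {last p, hd p} \<in> E"

definition girth :: "edges \<Rightarrow> enat" where
  "girth E = (INF p\<in>{p. cycle E p}. enat (length p))"

definition is_spanner :: "nat \<Rightarrow> nat \<Rightarrow> edges \<Rightarrow> edges \<Rightarrow> bool" where
  "is_spanner \<alpha> n G H \<longleftrightarrow>
     H \<subseteq> G \<and> (\<forall>u<n. \<forall>v<n. graph_dist H u v \<le> enat \<alpha> * graph_dist G u v)"

text \<open>
  The bound \<open>\<Omega>(n\<^bsup>1+1/k\<^esup>)\<close> is read asymptotically, with a constant depending on \<open>k\<close>: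
  for the finitely many small \<open>n\<close> a graph of girth \<open>2k+2\<close> need not exist at all.
\<close>

definition erdos_girth_conjecture :: bool where
  "erdos_girth_conjecture \<longleftrightarrow>
     (\<forall>k\<ge>1. \<exists>c>0. \<forall>\<^sub>F n in sequentially. \<exists>E \<subseteq> all_edges n.
        girth E = enat (2 * k + 2) \<and> real (card E) \<ge> c * real n powr (1 + 1 / real k))"

text \<open>
  Message-passing protocols, one bit at a time. Players are numbered \<open>0, \<dots>, s - 1\<close>. In each step
  the coordinator, who sees the whole transcript, sends one bit to a player, lets a player send it
  one bit, or stops with an output. A player sees its own input and only the part of the transcript
  exchanged with itself. As every step costs one bit, no information is transmitted by free
  empty messages; longer messages are successive steps.
\<close>

datatype message = To_Player nat bool | From_Player nat bool

fun partner :: "message \<Rightarrow> nat" where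
  "partner (To_Player i b) = i"
| "partner (From_Player i b) = i"

type_synonym transcript = "message list"

datatype action = Send nat bool | Receive nat | Output edges

type_synonym coordinator = "transcript \<Rightarrow> action"
type_synonym player = "edges \<Rightarrow> transcript \<Rightarrow> bool"
type_synonym protocol = "coordinator \<times> (nat \<Rightarrow> player)"

definition player_view :: "nat \<Rightarrow> transcript \<Rightarrow> transcript" where
  "player_view i t = filter (\<lambda>m. partner m = i) t"

inductive reachable :: "protocol \<Rightarrow> (nat \<Rightarrow> edges) \<Rightarrow> transcript \<Rightarrow> bool"
  for \<pi> :: protocol and E :: "nat \<Rightarrow> edges" where
  start: "reachable \<pi> E []"
| send: "reachable \<pi> E t \<Longrightarrow> fst \<pi> t = Send i b \<Longrightarrow> reachable \<pi> E (t @ [To_Player i b])"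
| receive: "reachable \<pi> E t \<Longrightarrow> fst \<pi> t = Receive i \<Longrightarrow>
     reachable \<pi> E (t @ [From_Player i (snd \<pi> i (E i) (player_view i t))])"

definition outputs :: "protocol \<Rightarrow> (nat \<Rightarrow> edges) \<Rightarrow> edges \<Rightarrow> bool" where
  "outputs \<pi> E H \<longleftrightarrow> (\<exists>t. reachable \<pi> E t \<and> fst \<pi> t = Output H)"

text \<open>The length of the complete transcript, and \<open>\<infinity>\<close> if the protocol does not terminate.\<close>

definition bits_exchanged :: "protocol \<Rightarrow> (nat \<Rightarrow> edges) \<Rightarrow> enat" where
  "bits_exchanged \<pi> E = (SUP t\<in>{t. reachable \<pi> E t}. enat (length t))"

definition s_player_protocol :: "nat \<Rightarrow> protocol \<Rightarrow> bool" where
  "s_player_protocol s \<pi> \<longleftrightarrow>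
     (\<forall>t. case fst \<pi> t of Send i b \<Rightarrow> i < s | Receive i \<Rightarrow> i < s | Output H \<Rightarrow> True)"

text \<open>
  A randomized protocol is a distribution on deterministic ones. Public coins allow any joint
  distribution of the strategies of the parties; with private coins the strategies are independent.
\<close>

datatype coins = Public_Coins | Private_Coins

fun randomized_protocols :: "coins \<Rightarrow> nat \<Rightarrow> protocol pmf set" where
  "randomized_protocols Public_Coins s = {R. \<forall>\<pi>\<in>set_pmf R. s_player_protocol s \<pi>}"
| "randomized_protocols Private_Coins s =
     {R. (\<forall>\<pi>\<in>set_pmf R. s_player_protocol s \<pi>) \<and>
         (\<exists>C P. R = pair_pmf C (Pi_pmf {..<s} (\<lambda>_ _. False) P))}"

text \<open>The edge sets of different players may overlap.\<close>

definition inputs :: "nat \<Rightarrow> nat \<Rightarrow> (nat \<Rightarrow> edges) set" where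
  "inputs s n = {E. \<forall>i<s. E i \<subseteq> all_edges n}"

definition computes_spanner :: "nat \<Rightarrow> nat \<Rightarrow> nat \<Rightarrow> protocol pmf \<Rightarrow> bool" where
  "computes_spanner \<alpha> s n R \<longleftrightarrow>
     (\<forall>E\<in>inputs s n.
        measure_pmf.prob R {\<pi>. \<exists>H. outputs \<pi> E H \<and> is_spanner \<alpha> n (\<Union>i<s. E i) H} \<ge> 2 / 3)"

definition worst_case_bits :: "nat \<Rightarrow> nat \<Rightarrow> protocol pmf \<Rightarrow> enat" where
  "worst_case_bits s n R = (SUP E\<in>inputs s n. SUP \<pi>\<in>set_pmf R. bits_exchanged \<pi> E)"

definition spanner_cost :: "coins \<Rightarrow> nat \<Rightarrow> nat \<Rightarrow> nat \<Rightarrow> enat" where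
  "spanner_cost c \<alpha> s n =
     (INF R\<in>{R \<in> randomized_protocols c s. computes_spanner \<alpha> s n R}. worst_case_bits s n R)"

text \<open>
  Soft Landau notation, hiding \<open>poly (log n)\<close> factors. The left-hand side is extended so that an
  infinite cost satisfies no upper bound.
\<close>

definition soft_O :: "(nat \<Rightarrow> enat) \<Rightarrow> (nat \<Rightarrow> real) \<Rightarrow> bool" where
  "soft_O f g \<longleftrightarrow> (\<exists>C>0. \<exists>a::nat. \<forall>\<^sub>F n in sequentially.
     ereal_of_enat (f n) \<le> ereal (C * g n * ln (real n) ^ a))"

definition soft_Omega :: "(nat \<Rightarrow> enat) \<Rightarrow> (nat \<Rightarrow> real) \<Rightarrow> bool" where
  "soft_Omega f g \<longleftrightarrow> (\<exists>c>0. \<exists>a::nat. \<forall>\<^sub>F n in sequentially.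
     ereal (c * g n / ln (real n) ^ a) \<le> ereal_of_enat (f n))"

definition soft_Theta :: "(nat \<Rightarrow> enat) \<Rightarrow> (nat \<Rightarrow> real) \<Rightarrow> bool" where
  "soft_Theta f g \<longleftrightarrow> soft_O f g \<and> soft_Omega f g"

end

theory Submission
  imports Defs "HOL-Library.Sublist"
begin

text \<open>
  Upper bound: every player sends a maximal subgraph of its graph without cycles of length at most
  \<open>2k\<close>. By maximality it is a \<open>(2k-1)\<close>-spanner, by the Moore bound it has \<open>O(n\<^bsup>1+1/k\<^esup>)\<close> edges, and
  the union of spanners is a spanner of the union.

  Lower bound: if all players hold subsets of the edge set \<open>J\<close> of a graph of girth \<open>2k + 2\<close>, the only
  \<open>(2k-1)\<close>-spanner of the union is the union itself, so the coordinator computes the bitwise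
  disjunction of \<open>s\<close> vectors of length \<open>m = card J\<close>. Let \<open>D \<subseteq> J\<close> be random of density \<open>3 / 4\<close> and let every
  player hold a random part of \<open>D\<close> of density \<open>1 / 3\<close>. For a single player \<open>i\<close>, whose input is \<open>x\<close>, and
  \<open>y = J - D\<close>, this is the classical hard distribution for disjointness: a hidden uniform partition of
  \<open>J\<close> into \<open>A\<close> and \<open>B\<close>, and uniform \<open>x \<subseteq> A\<close>, \<open>y \<subseteq> B\<close>. If \<open>i\<close> exchanges few bits, then the level-one
  inequality shows that for most \<open>j\<close> the law of the view \<open>v\<close> of \<open>i\<close> hardly changes when \<open>j\<close> is moved
  into \<open>x\<close> or into \<open>y\<close>, in Hellinger distance. As the probability of \<open>v\<close> is a product of a function of
  \<open>x\<close> and a function of \<open>y\<close>, cut and paste extends this to moving \<open>j\<close> into both. But then the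
  coordinator cannot tell whether \<open>i\<close>, as the only player, holds \<open>j\<close>. So each of the \<open>s\<close> players
  exchanges \<open>\<Omega>(m)\<close> bits on average.
\<close>

section \<open>The two-party lower bound\<close>

definition avg :: "'a set \<Rightarrow> ('a set \<Rightarrow> real) \<Rightarrow> real" where
  "avg B F = (\<Sum>y\<in>Pow B. F y) / 2 ^ card B"

lemma sum_Pow_insert:
  fixes F :: "'a set \<Rightarrow> 'b :: comm_monoid_add"
  assumes "finite B" "j \<notin> B"
  shows "(\<Sum>y\<in>Pow (insert j B). F y) = (\<Sum>y\<in>Pow B. F y) + (\<Sum>y\<in>Pow B. F (insert j y))"
proof -
  have "inj_on (insert j) (Pow B)" and "Pow B \<inter> insert j ` Pow B = {}"
    using assms(2) by (auto simp: inj_on_def)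
  then show ?thesis
    using assms by (simp add: Pow_insert sum.union_disjoint sum.reindex)
qed

lemma sum_power_card_Pow:
  fixes c :: real
  assumes "finite D"
  shows "(\<Sum>x\<in>Pow D. c ^ card x) = (1 + c) ^ card D"
  using assms
proof induction
  case (insert j D)
  have "card (insert j x) = Suc (card x)" if "x \<subseteq> D" for x
    using that insert by (meson card_insert_disjoint finite_subset subsetD)
  then have "(\<Sum>x\<in>Pow D. c ^ card (insert j x)) = c * (\<Sum>x\<in>Pow D. c ^ card x)"
    by (simp add: sum_distrib_left)
  then show ?case
    using insert by (simp add: sum_Pow_insert algebra_simps)
qed simp

lemma avg_insert:
  assumes "finite B" "j \<notin> B"
  shows "avg (insert j B) F = (avg B F + avg B (\<lambda>y. F (insert j y))) / 2"
  using assms by (simp add: avg_def sum_Pow_insert field_simps)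

lemma avg_add: "avg B (\<lambda>y. F y + G y) = avg B F + avg B G"
  by (simp add: avg_def sum.distrib add_divide_distrib)

lemma avg_diff: "avg B (\<lambda>y. F y - G y) = avg B F - avg B G"
  by (simp add: avg_def sum_subtractf diff_divide_distrib)

lemma avg_cmult: "avg B (\<lambda>y. c * F y) = c * avg B F"
  by (simp add: avg_def sum_distrib_left)

lemma avg_multc: "avg B (\<lambda>y. F y * c) = avg B F * c"
  by (simp add: avg_def sum_distrib_right)

lemma avg_minus: "avg B (\<lambda>y. - F y) = - avg B F"
  by (simp add: avg_def sum_negf)

lemma avg_sum: "avg B (\<lambda>y. \<Sum>i\<in>I. F i y) = (\<Sum>i\<in>I. avg B (F i))"
  unfolding avg_def by (subst sum.swap) (simp add: sum_divide_distrib)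

lemma avg_const: "finite B \<Longrightarrow> avg B (\<lambda>_. c) = c"
  by (simp add: avg_def card_Pow)

lemma avg_mono: "(\<And>y. y \<subseteq> B \<Longrightarrow> F y \<le> G y) \<Longrightarrow> avg B F \<le> avg B G"
  unfolding avg_def by (intro divide_right_mono sum_mono) auto

lemma avg_cong: "(\<And>y. y \<subseteq> B \<Longrightarrow> F y = G y) \<Longrightarrow> avg B F = avg B G"
  unfolding avg_def by (intro arg_cong2[where f="(/)"] sum.cong) auto

lemma avg_nonneg: "(\<And>y. y \<subseteq> B \<Longrightarrow> 0 \<le> F y) \<Longrightarrow> 0 \<le> avg B F"
  unfolding avg_def by (intro divide_nonneg_nonneg sum_nonneg) auto

section \<open>Subgaussian moments and the level-one inequality\<close>

lemma cosh_le_exp_half_square: "(exp x + exp (- x)) / 2 \<le> exp (x\<^sup>2 / 2)" for x :: real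
proof -
  have *: "(exp x + exp (- x)) / 2 \<le> exp (x\<^sup>2 / 2)" if "0 \<le> x" for x :: real
  proof -
    \<comment> \<open>Hoeffding's lemma for a fair coin with values 0 and \<open>2 * x\<close>;
      multiplying by \<open>exp (- x)\<close> below recentres it.\<close>
    have "- (2 * x) * (1/2) + ln (1 + (1/2) * (exp (2 * x) - 1)) \<le> (2 * x)\<^sup>2 / 8"
      using that by (intro Hoeffdings_lemma_aux) auto
    then have "ln ((1 + exp (2 * x)) / 2) \<le> x + x\<^sup>2 / 2"
      by (simp add: field_simps power2_eq_square)
    then have "exp (ln ((1 + exp (2 * x)) / 2)) \<le> exp (x + x\<^sup>2 / 2)"
      by simp
    then have "(1 + exp (2 * x)) / 2 \<le> exp (x + x\<^sup>2 / 2)"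
      by (subst (asm) exp_ln) (simp_all add: add_pos_pos)
    then have "exp (- x) * ((1 + exp (2 * x)) / 2) \<le> exp (- x) * exp (x + x\<^sup>2 / 2)"
      by (intro mult_left_mono) auto
    then show ?thesis
      by (simp add: field_simps flip: exp_add)
  qed
  show ?thesis
    using *[of x] *[of "- x"] by (cases "x \<ge> 0") (auto simp: add.commute)
qed

text \<open>The Fourier character of \<open>{j}\<close> on the cube; for distinct \<open>j\<close>
  in \<open>B\<close> these are independent fair signs under \<open>avg B\<close>.\<close>

definition sgn_bit :: "'a \<Rightarrow> 'a set \<Rightarrow> real" where
  "sgn_bit j y = (if j \<in> y then - 1 else 1)"

lemma avg_exp_le:
  assumes "finite B"
  shows "avg B (\<lambda>y. exp (\<Sum>j\<in>B. e j * sgn_bit j y)) \<le> exp ((\<Sum>j\<in>B. (e j)\<^sup>2) / 2)"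
  using assms
proof induction
  case empty
  then show ?case by (simp add: avg_def)
next
  case (insert i B)
  let ?S = "\<lambda>y. \<Sum>j\<in>B. e j * sgn_bit j y"
  have 1: "avg B (\<lambda>y. exp (\<Sum>j\<in>insert i B. e j * sgn_bit j y)) = exp (e i) * avg B (\<lambda>y. exp (?S y))"
    unfolding avg_cmult[symmetric] using insert
    by (intro avg_cong) (auto simp: sgn_bit_def exp_add)
  have 2: "avg B (\<lambda>y. exp (\<Sum>j\<in>insert i B. e j * sgn_bit j (insert i y)))
      = exp (- e i) * avg B (\<lambda>y. exp (?S y))"
  proof -
    have "?S (insert i y) = ?S y" for y
      using insert by (intro sum.cong) (auto simp: sgn_bit_def)
    then show ?thesis
      unfolding avg_cmult[symmetric] using insert
      by (intro avg_cong) (auto simp: sgn_bit_def simp flip: exp_add)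
  qed
  have "avg (insert i B) (\<lambda>y. exp (\<Sum>j\<in>insert i B. e j * sgn_bit j y))
      = (exp (e i) + exp (- e i)) / 2 * avg B (\<lambda>y. exp (?S y))"
    using insert 1 2 by (subst avg_insert) (auto simp: algebra_simps add_divide_distrib)
  also have "\<dots> \<le> exp ((e i)\<^sup>2 / 2) * exp ((\<Sum>j\<in>B. (e j)\<^sup>2) / 2)"
    using insert.IH cosh_le_exp_half_square by (intro mult_mono) (auto intro!: avg_nonneg)
  also have "\<dots> = exp ((\<Sum>j\<in>insert i B. (e j)\<^sup>2) / 2)"
    using insert by (simp add: add_divide_distrib exp_add)
  finally show ?case .
qed

text \<open>The differences are twice the level-one Fourier coefficients of \<open>F\<close>. With
  the normalized coefficients \<open>e\<close> as weights, the linear form \<open>v\<close> has mean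
  \<open>S\<close> under the density \<open>F / p\<close>, while its uniform exponential moment is
  at most \<open>exp (S / 2)\<close>. As \<open>F\<close> is at most 1, Jensen's inequality gives
  \<open>p * exp S \<le> exp (S / 2)\<close>.\<close>

lemma level_one_inequality:
  fixes F :: "'a set \<Rightarrow> real"
  assumes B: "finite B" and F: "\<And>y. y \<subseteq> B \<Longrightarrow> 0 \<le> F y" "\<And>y. y \<subseteq> B \<Longrightarrow> F y \<le> 1"
  defines "p \<equiv> avg B F"
  shows "(\<Sum>j\<in>B. (avg (B - {j}) F - avg (B - {j}) (\<lambda>y. F (insert j y)))\<^sup>2) \<le> 8 * p\<^sup>2 * ln (1 / p)"
proof (cases "p = 0")
  case True
  then have F0: "F y = 0" if "y \<subseteq> B" for y
    using that F(1) B sum_nonneg_eq_0_iff[of "Pow B" F] by (auto simp: p_def avg_def)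
  have "avg (B - {j}) F - avg (B - {j}) (\<lambda>y. F (insert j y)) = 0" if "j \<in> B" for j
  proof -
    have "avg (B - {j}) F = avg (B - {j}) (\<lambda>_. 0)" "avg (B - {j}) (\<lambda>y. F (insert j y)) = avg (B - {j}) (\<lambda>_. 0)"
      using that by (auto intro!: avg_cong F0)
    then show ?thesis by simp
  qed
  then show ?thesis using True by simp
next
  case False
  then have p: "p > 0"
    using avg_nonneg[of B F] F(1) by (simp add: p_def order_less_le)
  define c where "c j = avg B (\<lambda>y. F y * sgn_bit j y)" for j
  have c: "avg (B - {j}) F - avg (B - {j}) (\<lambda>y. F (insert j y)) = 2 * c j" if j: "j \<in> B" for j
  proof -
    have "c j = (avg (B - {j}) (\<lambda>y. F y * sgn_bit j y)
        + avg (B - {j}) (\<lambda>y. F (insert j y) * sgn_bit j (insert j y))) / 2"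
      unfolding c_def using avg_insert[of "B - {j}" j "\<lambda>y. F y * sgn_bit j y"] B j by (simp add: insert_absorb)
    also have "avg (B - {j}) (\<lambda>y. F y * sgn_bit j y) = avg (B - {j}) F"
      by (intro avg_cong) (auto simp: sgn_bit_def)
    also have "avg (B - {j}) (\<lambda>y. F (insert j y) * sgn_bit j (insert j y))
        = avg (B - {j}) (\<lambda>y. - 1 * F (insert j y))"
      by (intro avg_cong) (auto simp: sgn_bit_def)
    finally show ?thesis by (simp add: avg_minus)
  qed
  define e where "e j = c j / p" for j
  define S where "S = (\<Sum>j\<in>B. (e j)\<^sup>2)"
  define v where "v y = (\<Sum>j\<in>B. e j * sgn_bit j y)" for y
  have v: "avg B (\<lambda>y. F y * v y) = p * S"
  proof -
    have "avg B (\<lambda>y. F y * v y) = (\<Sum>j\<in>B. avg B (\<lambda>y. e j * (F y * sgn_bit j y)))"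
      unfolding v_def avg_sum[symmetric] by (simp add: sum_distrib_left mult_ac)
    also have "\<dots> = p * S"
      using p unfolding avg_cmult S_def sum_distrib_left c_def[symmetric]
      by (intro sum.cong) (auto simp: e_def power2_eq_square)
    finally show ?thesis .
  qed
  \<comment> \<open>Jensen in tangent form: \<open>exp (v y)\<close> is at least
    \<open>exp S * (1 + (v y - S))\<close>, and \<open>v y - S\<close> averages to 0 with weight
    \<open>F\<close>.\<close>
  have "p * exp S = exp S * ((1 - S) * avg B F + avg B (\<lambda>y. F y * v y))"
    unfolding v by (simp add: p_def algebra_simps)
  also have "\<dots> = avg B (\<lambda>y. exp S * ((1 - S) * F y + F y * v y))"
    by (simp add: avg_add avg_cmult)
  also have "\<dots> \<le> avg B (\<lambda>y. exp (v y))"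
  proof (intro avg_mono)
    fix y assume y: "y \<subseteq> B"
    have "exp S * ((1 - S) * F y + F y * v y) = F y * (exp S * (1 + (v y - S)))"
      by (simp add: algebra_simps)
    also have "\<dots> \<le> F y * (exp S * exp (v y - S))"
      using F(1)[OF y] by (intro mult_left_mono exp_ge_add_one_self) auto
    also have "\<dots> = F y * exp (v y)" by (simp flip: exp_add)
    also have "\<dots> \<le> 1 * exp (v y)"
      using F(2)[OF y] by (intro mult_right_mono) auto
    finally show "exp S * ((1 - S) * F y + F y * v y) \<le> exp (v y)" by simp
  qed
  also have "\<dots> \<le> exp (S / 2)"
    unfolding v_def S_def by (rule avg_exp_le[OF B])
  finally have "p * (exp (S / 2) * exp (S / 2)) \<le> exp (S / 2)"
    by (simp flip: exp_add)
  then have "p * exp (S / 2) \<le> 1" by simp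
  then have "exp (S / 2) \<le> 1 / p"
    using p by (simp add: field_simps)
  then have "S \<le> 2 * ln (1 / p)"
    using p ln_mono[of "exp (S / 2)" "1 / p"] by simp
  have "(\<Sum>j\<in>B. (avg (B - {j}) F - avg (B - {j}) (\<lambda>y. F (insert j y)))\<^sup>2) = 4 * p\<^sup>2 * S"
    using p unfolding S_def sum_distrib_left
    by (intro sum.cong) (auto simp: c e_def power_divide)
  also have "\<dots> \<le> 4 * p\<^sup>2 * (2 * ln (1 / p))"
    using \<open>S \<le> _\<close> by (intro mult_left_mono) auto
  finally show ?thesis by simp
qed

section \<open>Hellinger terms, entropy and double counting\<close>

lemma sqrt_diff_square_le:
  fixes a b :: real
  assumes "0 \<le> a" "0 \<le> b"
  shows "(a + b) * (sqrt a - sqrt b)\<^sup>2 \<le> (a - b)\<^sup>2"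
proof -
  have "(a - b)\<^sup>2 = (sqrt a + sqrt b)\<^sup>2 * (sqrt a - sqrt b)\<^sup>2"
    using assms by (simp flip: power_mult_distrib add: algebra_simps flip: real_sqrt_mult)
  also have "(sqrt a + sqrt b)\<^sup>2 = a + b + 2 * (sqrt a * sqrt b)"
    using assms by (simp add: power2_eq_square algebra_simps)
  also have "\<dots> * (sqrt a - sqrt b)\<^sup>2 \<ge> (a + b) * (sqrt a - sqrt b)\<^sup>2"
    using assms by (intro mult_right_mono) auto
  finally show ?thesis .
qed

text \<open>For every \<open>j\<close> the two averages add up to \<open>2 * p\<close>. Dividing the
  level-one bound by this sum yields Hellinger terms and leaves a single factor \<open>p\<close>, so
  that summing over transcripts produces an entropy.\<close>

lemma sum_sqrt_diff_le:
  fixes F :: "'a set \<Rightarrow> real"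
  assumes B: "finite B" and F: "\<And>y. 0 \<le> F y" "\<And>y. y \<subseteq> B \<Longrightarrow> F y \<le> 1"
  defines "p \<equiv> avg B F"
  shows "(\<Sum>j\<in>B. (sqrt (avg (B - {j}) F) - sqrt (avg (B - {j}) (\<lambda>y. F (insert j y))))\<^sup>2)
    \<le> 4 * p * ln (1 / p)"
proof -
  define u where "u j = avg (B - {j}) F" for j
  define w where "w j = avg (B - {j}) (\<lambda>y. F (insert j y))" for j
  have nn: "0 \<le> u j" "0 \<le> w j" for j
    using F(1) by (auto simp: u_def w_def intro!: avg_nonneg)
  have uw: "u j + w j = 2 * p" if "j \<in> B" for j
    using avg_insert[of "B - {j}" j F] B that by (simp add: u_def w_def p_def insert_absorb)
  have p: "0 \<le> p" using F(1) by (auto simp: p_def intro!: avg_nonneg)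
  have "2 * p * (\<Sum>j\<in>B. (sqrt (u j) - sqrt (w j))\<^sup>2) = (\<Sum>j\<in>B. (u j + w j) * (sqrt (u j) - sqrt (w j))\<^sup>2)"
    unfolding sum_distrib_left using uw by (intro sum.cong) auto
  also have "\<dots> \<le> (\<Sum>j\<in>B. (u j - w j)\<^sup>2)"
    using nn by (intro sum_mono sqrt_diff_square_le) auto
  also have "\<dots> \<le> 8 * p\<^sup>2 * ln (1 / p)"
    unfolding u_def w_def p_def using F by (intro level_one_inequality B) auto
  finally have "2 * p * (\<Sum>j\<in>B. (sqrt (u j) - sqrt (w j))\<^sup>2) \<le> 2 * p * (4 * p * ln (1 / p))"
    by (simp add: power2_eq_square)
  then have *: "(\<Sum>j\<in>B. (sqrt (u j) - sqrt (w j))\<^sup>2) \<le> 4 * p * ln (1 / p)" if "p > 0"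
    using that by simp
  show ?thesis
  proof (cases "p > 0")
    case True
    then show ?thesis using * by (simp add: u_def w_def)
  next
    case False
    then have "p = 0" using p by simp
    then have "u j = 0" "w j = 0" if "j \<in> B" for j
      using uw[OF that] nn[of j] by auto
    then show ?thesis using \<open>p = 0\<close> by (simp add: u_def w_def)
  qed
qed

text \<open>Nonnegativity of relative entropy, with \<open>q\<close> allowed to lose mass. A
  \<open>q\<close> that is geometric in the length of a transcript will turn entropy into expected
  length.\<close>

lemma gibbs_inequality:
  fixes p q :: "'v \<Rightarrow> real"
  assumes "\<And>v. v \<in> V \<Longrightarrow> 0 \<le> p v" "(\<Sum>v\<in>V. p v) = 1"
    and "\<And>v. v \<in> V \<Longrightarrow> 0 < q v" "(\<Sum>v\<in>V. q v) \<le> 1"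
  shows "(\<Sum>v\<in>V. p v * ln (1 / p v)) \<le> (\<Sum>v\<in>V. p v * ln (1 / q v))"
proof -
  have "(\<Sum>v\<in>V. p v * ln (1 / p v)) \<le> (\<Sum>v\<in>V. p v * ln (1 / q v) + (q v - p v))"
  proof (intro sum_mono)
    fix v assume v: "v \<in> V"
    show "p v * ln (1 / p v) \<le> p v * ln (1 / q v) + (q v - p v)"
    proof (cases "p v = 0")
      case True
      then show ?thesis using assms(3)[OF v] by simp
    next
      case False
      then have p: "p v > 0" using assms(1)[OF v] by simp
      have "ln (q v / p v) \<le> q v / p v - 1"
        using p assms(3)[OF v] by (intro ln_le_minus_one) auto
      then have "p v * ln (q v / p v) \<le> p v * (q v / p v - 1)"
        using p by (intro mult_left_mono) auto
      then show ?thesis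
        using p assms(3)[OF v] by (simp add: ln_div algebra_simps)
    qed
  qed
  also have "\<dots> \<le> (\<Sum>v\<in>V. p v * ln (1 / q v))"
    using assms by (simp add: sum.distrib sum_subtractf)
  finally show ?thesis .
qed

text \<open>Both forms count pairs of a coordinate and a set avoiding it. Thus moves of
  \<open>j\<close> into \<open>y\<close> (with \<open>j\<close> outside \<open>A\<close>) and into
  \<open>x\<close> (with \<open>j\<close> taken out of \<open>A\<close>) are summed over the same
  partitions of \<open>J - {j}\<close>.\<close>

lemma sum_Pow_swap:
  fixes f :: "'a \<Rightarrow> 'a set \<Rightarrow> real"
  assumes "finite J"
  shows "(\<Sum>A\<in>Pow J. \<Sum>j\<in>J - A. f j A) = (\<Sum>j\<in>J. \<Sum>A\<in>Pow (J - {j}). f j A)"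
    and "(\<Sum>A\<in>Pow J. \<Sum>j\<in>A. f j (A - {j})) = (\<Sum>j\<in>J. \<Sum>A\<in>Pow (J - {j}). f j A)"
proof -
  have fin: "finite (Pow J)" "\<And>A. A \<in> Pow J \<Longrightarrow> finite (J - A)" "\<And>A. A \<in> Pow J \<Longrightarrow> finite A"
     "\<And>j. finite (Pow (J - {j}))"
    using assms finite_subset by auto
  have "(\<Sum>A\<in>Pow J. \<Sum>j\<in>J - A. f j A) = (\<Sum>(A, j)\<in>Sigma (Pow J) (\<lambda>A. J - A). f j A)"
    using fin by (subst sum.Sigma) auto
  also have "\<dots> = (\<Sum>(j, A)\<in>Sigma J (\<lambda>j. Pow (J - {j})). f j A)"
    by (rule sum.reindex_bij_witness[where i="\<lambda>(j, A). (A, j)" and j="\<lambda>(A, j). (j, A)"]) auto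
  also have "\<dots> = (\<Sum>j\<in>J. \<Sum>A\<in>Pow (J - {j}). f j A)"
    using assms fin by (subst sum.Sigma) auto
  finally show "(\<Sum>A\<in>Pow J. \<Sum>j\<in>J - A. f j A) = (\<Sum>j\<in>J. \<Sum>A\<in>Pow (J - {j}). f j A)" .
  have "(\<Sum>A\<in>Pow J. \<Sum>j\<in>A. f j (A - {j})) = (\<Sum>(A, j)\<in>Sigma (Pow J) (\<lambda>A. A). f j (A - {j}))"
    using fin by (subst sum.Sigma) auto
  also have "\<dots> = (\<Sum>(j, A)\<in>Sigma J (\<lambda>j. Pow (J - {j})). f j A)"
    by (rule sum.reindex_bij_witness[where i="\<lambda>(j, A). (insert j A, j)" and j="\<lambda>(A, j). (j, A - {j})"]) auto
  also have "\<dots> = (\<Sum>j\<in>J. \<Sum>A\<in>Pow (J - {j}). f j A)"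
    using assms fin by (subst sum.Sigma) auto
  finally show "(\<Sum>A\<in>Pow J. \<Sum>j\<in>A. f j (A - {j})) = (\<Sum>j\<in>J. \<Sum>A\<in>Pow (J - {j}). f j A)" .
qed

section \<open>Hellinger distances for product transcript laws\<close>

text \<open>On inputs \<open>x\<close> and \<open>y\<close> the transcript \<open>v\<close> has probability \<open>a v x * b v y\<close>.\<close>

locale two_party =
  fixes J :: "'a set" and V :: "'v set" and a b :: "'v \<Rightarrow> 'a set \<Rightarrow> real"
  assumes finite_J: "finite J" and finite_V: "finite V"
    and a_nonneg: "\<And>v x. 0 \<le> a v x" and b_nonneg: "\<And>v y. 0 \<le> b v y"
    and total: "\<And>x y. x \<subseteq> J \<Longrightarrow> y \<subseteq> J \<Longrightarrow> (\<Sum>v\<in>V. a v x * b v y) = 1"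
begin

text \<open>The law of the transcript given the hidden partition: \<open>x\<close> and
  \<open>y\<close> are independent and uniform in \<open>A\<close> and \<open>J - A\<close>, so the
  average factors.\<close>

definition transcript_prob :: "'a set \<Rightarrow> 'v \<Rightarrow> real" where
  "transcript_prob A v = avg A (a v) * avg (J - A) (b v)"

text \<open>Twice the squared Hellinger distance between the laws of the transcript before and after
  \<open>j\<close> enters \<open>y\<close>. Here \<open>A\<close> only splits the other
  coordinates.\<close>

definition hellinger_y :: "'a \<Rightarrow> 'a set \<Rightarrow> real" where
  "hellinger_y j A = (\<Sum>v\<in>V. (sqrt (avg A (a v) * avg (J - {j} - A) (b v))
     - sqrt (avg A (a v) * avg (J - {j} - A) (\<lambda>y. b v (insert j y))))\<^sup>2)"

definition hellinger_x :: "'a \<Rightarrow> 'a set \<Rightarrow> real" where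
  "hellinger_x j A = (\<Sum>v\<in>V. (sqrt (avg A (a v) * avg (J - {j} - A) (b v))
     - sqrt (avg A (\<lambda>x. a v (insert j x)) * avg (J - {j} - A) (b v)))\<^sup>2)"

lemma finite_sub: "A \<subseteq> J \<Longrightarrow> finite A"
  using finite_J finite_subset by auto

lemma avg_total:
  assumes "A \<subseteq> J" "y \<subseteq> J"
  shows "(\<Sum>v\<in>V. avg A (a v) * b v y) = 1"
proof -
  have "(\<Sum>v\<in>V. avg A (a v) * b v y) = avg A (\<lambda>x. \<Sum>v\<in>V. b v y * a v x)"
    by (simp add: avg_sum avg_cmult) (simp add: mult.commute)
  also have "\<dots> = avg A (\<lambda>_. 1)"
    using assms by (intro avg_cong) (simp add: total mult.commute)
  finally show ?thesis using assms finite_sub by (simp add: avg_const)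
qed

lemma avg_total':
  assumes "B \<subseteq> J" "x \<subseteq> J"
  shows "(\<Sum>v\<in>V. a v x * avg B (b v)) = 1"
proof -
  have "(\<Sum>v\<in>V. a v x * avg B (b v)) = avg B (\<lambda>y. \<Sum>v\<in>V. a v x * b v y)"
    by (simp add: avg_sum avg_cmult)
  also have "\<dots> = avg B (\<lambda>_. 1)"
    using assms by (intro avg_cong) (simp add: total)
  finally show ?thesis using assms finite_sub by (simp add: avg_const)
qed

lemma avg_avg_total:
  assumes "\<And>x. x \<subseteq> A \<Longrightarrow> f x \<subseteq> J" "\<And>y. y \<subseteq> B \<Longrightarrow> g y \<subseteq> J" "finite A" "finite B"
  shows "(\<Sum>v\<in>V. avg A (\<lambda>x. a v (f x)) * avg B (\<lambda>y. b v (g y))) = 1"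
proof -
  have "(\<Sum>v\<in>V. avg A (\<lambda>x. a v (f x)) * avg B (\<lambda>y. b v (g y)))
      = avg A (\<lambda>x. avg B (\<lambda>y. \<Sum>v\<in>V. a v (f x) * b v (g y)))"
    unfolding avg_sum avg_cmult avg_multc ..
  also have "\<dots> = avg A (\<lambda>x. avg B (\<lambda>y. 1))"
    using assms by (intro avg_cong) (simp add: total)
  finally show ?thesis using assms by (simp add: avg_const)
qed

lemma sum_transcript_prob:
  assumes "A \<subseteq> J" shows "(\<Sum>v\<in>V. transcript_prob A v) = 1"
  unfolding transcript_prob_def using avg_avg_total[of A "\<lambda>x. x" "J - A" "\<lambda>y. y"] assms finite_sub finite_J
  by auto

lemma transcript_prob_nonneg: "0 \<le> transcript_prob A v"
  unfolding transcript_prob_def using a_nonneg b_nonneg by (intro mult_nonneg_nonneg avg_nonneg)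

text \<open>For a fixed transcript, \<open>sum_sqrt_diff_le\<close> is applied to the function of
  \<open>y\<close> that remains after averaging over \<open>x\<close>; it is a probability, hence at
  most 1.\<close>

lemma sum_hellinger_y_le:
  assumes "A \<subseteq> J"
  shows "(\<Sum>j\<in>J - A. hellinger_y j A) \<le> 4 * (\<Sum>v\<in>V. transcript_prob A v * ln (1 / transcript_prob A v))"
proof -
  let ?F = "\<lambda>v y. avg A (a v) * b v y"
  have eq: "J - {j} - A = J - A - {j}" for j by auto
  have nn: "0 \<le> ?F v y" for v y
    using a_nonneg b_nonneg by (intro mult_nonneg_nonneg avg_nonneg)
  have "(\<Sum>j\<in>J - A. hellinger_y j A) = (\<Sum>v\<in>V. \<Sum>j\<in>J - A.
      (sqrt (avg (J - A - {j}) (?F v)) - sqrt (avg (J - A - {j}) (\<lambda>y. ?F v (insert j y))))\<^sup>2)"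
    unfolding hellinger_y_def by (subst sum.swap) (simp add: avg_cmult eq)
  also have "\<dots> \<le> (\<Sum>v\<in>V. 4 * avg (J - A) (?F v) * ln (1 / avg (J - A) (?F v)))"
  proof (intro sum_mono sum_sqrt_diff_le)
    fix v y assume v: "v \<in> V" and y: "y \<subseteq> J - A"
    have "?F v y \<le> (\<Sum>v\<in>V. ?F v y)"
      using v nn finite_V by (intro member_le_sum) auto
    moreover have "y \<subseteq> J" using y by auto
    ultimately show "?F v y \<le> 1" using avg_total[of A y] assms by simp
  qed (use finite_J nn in auto)
  finally show ?thesis
    by (simp add: avg_cmult transcript_prob_def sum_distrib_left mult.assoc)
qed

lemma sum_hellinger_x_le:
  assumes "A \<subseteq> J"
  shows "(\<Sum>j\<in>A. hellinger_x j (A - {j})) \<le> 4 * (\<Sum>v\<in>V. transcript_prob A v * ln (1 / transcript_prob A v))"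
proof -
  let ?F = "\<lambda>v x. avg (J - A) (b v) * a v x"
  have eq: "J - {j} - (A - {j}) = J - A" if "j \<in> A" for j using that by auto
  have nn: "0 \<le> ?F v y" for v y
    using a_nonneg b_nonneg by (intro mult_nonneg_nonneg avg_nonneg)
  have "(\<Sum>j\<in>A. hellinger_x j (A - {j})) = (\<Sum>j\<in>A. \<Sum>v\<in>V.
      (sqrt (avg (A - {j}) (?F v)) - sqrt (avg (A - {j}) (\<lambda>x. ?F v (insert j x))))\<^sup>2)"
    unfolding hellinger_x_def by (intro sum.cong) (simp_all add: avg_cmult eq mult.commute[of _ "avg (J - A) _"])
  also have "\<dots> = (\<Sum>v\<in>V. \<Sum>j\<in>A.
      (sqrt (avg (A - {j}) (?F v)) - sqrt (avg (A - {j}) (\<lambda>x. ?F v (insert j x))))\<^sup>2)"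
    by (rule sum.swap)
  also have "\<dots> \<le> (\<Sum>v\<in>V. 4 * avg A (?F v) * ln (1 / avg A (?F v)))"
  proof (intro sum_mono sum_sqrt_diff_le)
    fix v x assume v: "v \<in> V" and x: "x \<subseteq> A"
    have "?F v x \<le> (\<Sum>v\<in>V. ?F v x)"
      using v nn finite_V by (intro member_le_sum) auto
    moreover have "x \<subseteq> J" using x assms by auto
    ultimately show "?F v x \<le> 1" using avg_total'[of "J - A" x] by (simp add: mult.commute)
  qed (use finite_sub assms nn in auto)
  finally show ?thesis
    by (simp add: avg_cmult transcript_prob_def sum_distrib_left mult.assoc mult.commute[of _ "avg (J - A) _"])
qed

text \<open>Each of the two directions contributes 4, and \<open>J\<close> has twice as many subsets
  as \<open>J - {j}\<close>.\<close>

lemma sum_hellinger_le: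
  "(\<Sum>j\<in>J. avg (J - {j}) (\<lambda>A. hellinger_x j A + hellinger_y j A))
    \<le> 16 * avg J (\<lambda>A. \<Sum>v\<in>V. transcript_prob A v * ln (1 / transcript_prob A v))"
proof -
  let ?H = "\<lambda>A. \<Sum>v\<in>V. transcript_prob A v * ln (1 / transcript_prob A v)"
  have card: "2 * 2 ^ card (J - {j}) = (2 :: real) ^ card J" if "j \<in> J" for j
    using card.remove[OF finite_J that] by simp
  have "2 ^ card J * (\<Sum>j\<in>J. avg (J - {j}) (\<lambda>A. hellinger_x j A + hellinger_y j A))
      = (\<Sum>j\<in>J. 2 * (\<Sum>A\<in>Pow (J - {j}). hellinger_x j A + hellinger_y j A))"
    unfolding sum_distrib_left[of "2 ^ card J"]
  proof (intro sum.cong refl)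
    fix j assume "j \<in> J"
    show "2 ^ card J * avg (J - {j}) (\<lambda>A. hellinger_x j A + hellinger_y j A)
      = 2 * (\<Sum>A\<in>Pow (J - {j}). hellinger_x j A + hellinger_y j A)"
      unfolding card[OF \<open>j \<in> J\<close>, symmetric] by (simp add: avg_def)
  qed
  also have "\<dots> = 2 * (\<Sum>A\<in>Pow J. (\<Sum>j\<in>A. hellinger_x j (A - {j})) + (\<Sum>j\<in>J - A. hellinger_y j A))"
    unfolding sum.distrib sum_Pow_swap[OF finite_J]
    by (simp add: sum_distrib_left sum.distrib algebra_simps)
  also have "\<dots> \<le> 2 * (\<Sum>A\<in>Pow J. 4 * ?H A + 4 * ?H A)"
    by (intro mult_left_mono sum_mono add_mono sum_hellinger_x_le sum_hellinger_y_le) auto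
  also have "\<dots> = 2 ^ card J * (16 * avg J ?H)"
    by (simp add: avg_def flip: sum_distrib_left)
  finally show ?thesis
    by simp
qed

text \<open>With \<open>j\<close> in \<open>y\<close>, the triangle inequality leads to
  \<open>j\<close> in both sets through \<open>j\<close> in neither. Cut and paste replaces the
  distance from neither to both by that between the two laws with \<open>j\<close> in exactly one
  set, which is again bounded through neither. Weighted AM-GM passes from Hellinger to L1
  distance.\<close>

lemma sum_transcript_diff_le:
  assumes j: "j \<in> J" and A: "A \<subseteq> J - {j}" and \<theta>: "\<theta> > 0"
  defines "B \<equiv> J - {j} - A"
  shows "(\<Sum>v\<in>V. \<bar>avg A (a v) - avg A (\<lambda>x. a v (insert j x))\<bar> * avg B (\<lambda>y. b v (insert j y)))
    \<le> \<theta> + 6 / \<theta> * (hellinger_x j A + hellinger_y j A)"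
proof -
  \<comment> \<open>\<open>s\<close> and \<open>t\<close> stand for \<open>x\<close> without and
    with \<open>j\<close>, \<open>u\<close> and \<open>w\<close> for \<open>y\<close> without and
    with \<open>j\<close>.\<close>
  define s where "s v = sqrt (avg A (a v))" for v
  define t where "t v = sqrt (avg A (\<lambda>x. a v (insert j x)))" for v
  define u where "u v = sqrt (avg B (b v))" for v
  define w where "w v = sqrt (avg B (\<lambda>y. b v (insert j y)))" for v
  have a0: "avg A (a v) = (s v)\<^sup>2" and a1: "avg A (\<lambda>x. a v (insert j x)) = (t v)\<^sup>2"
    and b0: "avg B (b v) = (u v)\<^sup>2" and b1: "avg B (\<lambda>y. b v (insert j y)) = (w v)\<^sup>2" for v
    using a_nonneg b_nonneg by (simp_all add: s_def t_def u_def w_def avg_nonneg)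
  have nn: "0 \<le> s v" "0 \<le> t v" "0 \<le> u v" "0 \<le> w v" for v
    using a_nonneg b_nonneg by (simp_all add: s_def t_def u_def w_def avg_nonneg)
  have fin: "finite A" "finite B" using A finite_J finite_subset by (auto simp: B_def)
  have tot: "(\<Sum>v\<in>V. (s v)\<^sup>2 * (u v)\<^sup>2) = 1" "(\<Sum>v\<in>V. (s v)\<^sup>2 * (w v)\<^sup>2) = 1"
    "(\<Sum>v\<in>V. (t v)\<^sup>2 * (u v)\<^sup>2) = 1" "(\<Sum>v\<in>V. (t v)\<^sup>2 * (w v)\<^sup>2) = 1"
    unfolding a0[symmetric] a1[symmetric] b0[symmetric] b1[symmetric]
    using j A fin by (intro avg_avg_total; auto simp: B_def)+
  have sq: "sqrt ((c v)\<^sup>2 * (d v)\<^sup>2) = c v * d v" if "0 \<le> c v" "0 \<le> d v" for c d :: "'v \<Rightarrow> real" and v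
    using that by (simp add: real_sqrt_mult)
  have hx: "hellinger_x j A = (\<Sum>v\<in>V. (s v * u v - t v * u v)\<^sup>2)"
    unfolding hellinger_x_def B_def[symmetric] a0 a1 b0 by (simp add: sq nn)
  have hy: "hellinger_y j A = (\<Sum>v\<in>V. (s v * u v - s v * w v)\<^sup>2)"
    unfolding hellinger_y_def B_def[symmetric] a0 b0 b1 by (simp add: sq nn)
  \<comment> \<open>Cut and paste: both sides equal \<open>2 - 2 * (\<Sum>v\<in>V. s v * t v * u v * w v)\<close>.\<close>
  have cut: "(\<Sum>v\<in>V. (s v * u v - t v * w v)\<^sup>2) = (\<Sum>v\<in>V. (s v * w v - t v * u v)\<^sup>2)"
  proof -
    have "(\<Sum>v\<in>V. (s v * u v - t v * w v)\<^sup>2) = (\<Sum>v\<in>V. (s v)\<^sup>2 * (u v)\<^sup>2) + (\<Sum>v\<in>V. (t v)\<^sup>2 * (w v)\<^sup>2)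
        - 2 * (\<Sum>v\<in>V. s v * t v * u v * w v)"
      unfolding sum_distrib_left sum.distrib[symmetric] sum_subtractf[symmetric]
      by (intro sum.cong) (simp_all add: power2_eq_square algebra_simps)
    moreover have "(\<Sum>v\<in>V. (s v * w v - t v * u v)\<^sup>2) = (\<Sum>v\<in>V. (s v)\<^sup>2 * (w v)\<^sup>2) + (\<Sum>v\<in>V. (t v)\<^sup>2 * (u v)\<^sup>2)
        - 2 * (\<Sum>v\<in>V. s v * t v * u v * w v)"
      unfolding sum_distrib_left sum.distrib[symmetric] sum_subtractf[symmetric]
      by (intro sum.cong) (simp_all add: power2_eq_square algebra_simps)
    ultimately show ?thesis using tot by simp
  qed
  have sq2: "(x + y)\<^sup>2 \<le> 2 * x\<^sup>2 + 2 * y\<^sup>2" for x y :: real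
    using zero_le_power2[of "x - y"] by (simp add: power2_eq_square algebra_simps)
  have "(\<Sum>v\<in>V. (s v * w v - t v * w v)\<^sup>2)
      \<le> (\<Sum>v\<in>V. 2 * (s v * u v - s v * w v)\<^sup>2 + 2 * (s v * u v - t v * w v)\<^sup>2)"
  proof (intro sum_mono)
    fix v
    have "(s v * w v - t v * w v)\<^sup>2 = (- (s v * u v - s v * w v) + (s v * u v - t v * w v))\<^sup>2"
      by simp
    also have "\<dots> \<le> 2 * (- (s v * u v - s v * w v))\<^sup>2 + 2 * (s v * u v - t v * w v)\<^sup>2"
      by (rule sq2)
    finally show "(s v * w v - t v * w v)\<^sup>2 \<le> 2 * (s v * u v - s v * w v)\<^sup>2 + 2 * (s v * u v - t v * w v)\<^sup>2"
      by (simp only: power2_minus)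
  qed
  also have "\<dots> = 2 * hellinger_y j A + 2 * (\<Sum>v\<in>V. (s v * w v - t v * u v)\<^sup>2)"
    by (simp add: hy sum.distrib flip: sum_distrib_left cut)
  also have "(\<Sum>v\<in>V. (s v * w v - t v * u v)\<^sup>2)
      \<le> (\<Sum>v\<in>V. 2 * (s v * u v - s v * w v)\<^sup>2 + 2 * (s v * u v - t v * u v)\<^sup>2)"
  proof (intro sum_mono)
    fix v
    have "(s v * w v - t v * u v)\<^sup>2 = (- (s v * u v - s v * w v) + (s v * u v - t v * u v))\<^sup>2"
      by simp
    also have "\<dots> \<le> 2 * (- (s v * u v - s v * w v))\<^sup>2 + 2 * (s v * u v - t v * u v)\<^sup>2"
      by (rule sq2)
    finally show "(s v * w v - t v * u v)\<^sup>2 \<le> 2 * (s v * u v - s v * w v)\<^sup>2 + 2 * (s v * u v - t v * u v)\<^sup>2"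
      by (simp only: power2_minus)
  qed
  also have "\<dots> = 2 * hellinger_y j A + 2 * hellinger_x j A"
    by (simp add: hx hy sum.distrib flip: sum_distrib_left)
  \<comment> \<open>The triangle inequalities leave six times the \<open>y\<close> term and four
    times the \<open>x\<close> term, rounded up for symmetry.\<close>
  finally have D: "(\<Sum>v\<in>V. (s v * w v - t v * w v)\<^sup>2) \<le> 6 * (hellinger_x j A + hellinger_y j A)"
    using sum_nonneg[of V "\<lambda>v. (s v * u v - t v * u v)\<^sup>2"] by (simp add: hx)
  have "(\<Sum>v\<in>V. \<bar>(s v)\<^sup>2 - (t v)\<^sup>2\<bar> * (w v)\<^sup>2)
      \<le> (\<Sum>v\<in>V. \<theta> / 2 * ((s v)\<^sup>2 * (w v)\<^sup>2 + (t v)\<^sup>2 * (w v)\<^sup>2) + 1 / \<theta> * (s v * w v - t v * w v)\<^sup>2)"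
  proof (intro sum_mono)
    fix v
    define x where "x = (s v + t v) * w v"
    define y where "y = \<bar>s v - t v\<bar> * w v"
    have "\<bar>(s v)\<^sup>2 - (t v)\<^sup>2\<bar> * (w v)\<^sup>2 = x * y"
      using nn by (simp add: x_def y_def power2_eq_square square_diff_square_factored abs_mult)
    \<comment> \<open>After the next bound the first term is \<open>\<theta> / 2\<close> times a sum
      of two probabilities, so it totals \<theta> over \<open>V\<close>.\<close>
    also have "x * y \<le> \<theta> / 4 * x\<^sup>2 + 1 / \<theta> * y\<^sup>2"
      using zero_le_power2[of "\<theta> * x - 2 * y"] \<theta> by (simp add: power2_eq_square field_simps)
    also have "x\<^sup>2 \<le> 2 * ((s v)\<^sup>2 * (w v)\<^sup>2 + (t v)\<^sup>2 * (w v)\<^sup>2)"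
    proof -
      have "x\<^sup>2 = (s v + t v)\<^sup>2 * (w v)\<^sup>2" by (simp only: x_def power_mult_distrib)
      also have "\<dots> \<le> (2 * (s v)\<^sup>2 + 2 * (t v)\<^sup>2) * (w v)\<^sup>2"
        by (intro mult_right_mono sq2) simp
      finally show ?thesis by (simp only: distrib_left distrib_right mult.assoc)
    qed
    also have "y\<^sup>2 = (s v * w v - t v * w v)\<^sup>2"
      unfolding y_def left_diff_distrib[symmetric] power_mult_distrib by simp
    finally show "\<bar>(s v)\<^sup>2 - (t v)\<^sup>2\<bar> * (w v)\<^sup>2
        \<le> \<theta> / 2 * ((s v)\<^sup>2 * (w v)\<^sup>2 + (t v)\<^sup>2 * (w v)\<^sup>2) + 1 / \<theta> * (s v * w v - t v * w v)\<^sup>2"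
      using \<theta> by (simp add: distrib_left add_divide_distrib)
  qed
  also have "\<dots> = \<theta> + 1 / \<theta> * (\<Sum>v\<in>V. (s v * w v - t v * w v)\<^sup>2)"
    unfolding sum.distrib sum_distrib_left[symmetric] using tot by simp
  also have "\<dots> \<le> \<theta> + 1 / \<theta> * (6 * (hellinger_x j A + hellinger_y j A))"
    using D \<theta> by (intro add_left_mono mult_left_mono) auto
  finally show ?thesis
    unfolding a0 a1 b1 by simp
qed

text \<open>
  \<open>z j v y\<close> is the weight of the transcript \<open>v\<close> together with the second party declaring that
  \<open>j\<close> is not in the union, so the left-hand side is the total advantage in detecting the element \<open>j\<close>
  of the first party.
\<close>

lemma total_advantage_le:
  fixes \<theta> :: real
  assumes z: "\<And>j v y. 0 \<le> z j v y" "\<And>j v y. z j v y \<le> b v y" and \<theta>: "\<theta> > 0"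
    and q: "\<And>v. v \<in> V \<Longrightarrow> 0 < q v" "(\<Sum>v\<in>V. q v) \<le> 1"
  shows "(\<Sum>j\<in>J. avg (J - {j}) (\<lambda>A. \<Sum>v\<in>V. (avg A (a v) - avg A (\<lambda>x. a v (insert j x)))
          * avg (J - {j} - A) (\<lambda>y. z j v (insert j y))))
    \<le> \<theta> * card J + 96 / \<theta> * avg J (\<lambda>A. \<Sum>v\<in>V. transcript_prob A v * ln (1 / q v))"
    (is "?L \<le> _")
proof -
  have "?L \<le> (\<Sum>j\<in>J. avg (J - {j}) (\<lambda>A. \<theta> + 6 / \<theta> * (hellinger_x j A + hellinger_y j A)))"
  proof (intro sum_mono avg_mono)
    fix j A assume j: "j \<in> J" and A: "A \<subseteq> J - {j}"
    have "(\<Sum>v\<in>V. (avg A (a v) - avg A (\<lambda>x. a v (insert j x))) * avg (J - {j} - A) (\<lambda>y. z j v (insert j y)))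
      \<le> (\<Sum>v\<in>V. \<bar>avg A (a v) - avg A (\<lambda>x. a v (insert j x))\<bar> * avg (J - {j} - A) (\<lambda>y. b v (insert j y)))"
      using z by (intro sum_mono mult_mono avg_mono avg_nonneg) auto
    also have "\<dots> \<le> \<theta> + 6 / \<theta> * (hellinger_x j A + hellinger_y j A)"
      by (rule sum_transcript_diff_le[OF j A \<theta>])
    finally show "(\<Sum>v\<in>V. (avg A (a v) - avg A (\<lambda>x. a v (insert j x))) * avg (J - {j} - A) (\<lambda>y. z j v (insert j y)))
      \<le> \<theta> + 6 / \<theta> * (hellinger_x j A + hellinger_y j A)" .
  qed
  also have "\<dots> = \<theta> * card J + 6 / \<theta> * (\<Sum>j\<in>J. avg (J - {j}) (\<lambda>A. hellinger_x j A + hellinger_y j A))"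
    unfolding avg_add avg_cmult sum.distrib sum_distrib_left distrib_left
    using finite_J by (simp add: avg_const)
  also have "\<dots> \<le> \<theta> * card J + 6 / \<theta> * (16 * avg J (\<lambda>A. \<Sum>v\<in>V. transcript_prob A v * ln (1 / q v)))"
  proof (intro add_left_mono mult_left_mono order.trans[OF sum_hellinger_le] avg_mono gibbs_inequality)
  qed (use \<theta> q transcript_prob_nonneg sum_transcript_prob in auto)
  finally show ?thesis by simp
qed

end

section \<open>Views of a player\<close>

definition step :: "protocol \<Rightarrow> (nat \<Rightarrow> edges) \<Rightarrow> transcript \<Rightarrow> transcript" where
  "step \<pi> E t = (case fst \<pi> t of
     Send i b \<Rightarrow> t @ [To_Player i b]
   | Receive i \<Rightarrow> t @ [From_Player i (snd \<pi> i (E i) (player_view i t))]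
   | Output H \<Rightarrow> t)"

text \<open>An output state is a fixed point of \<open>step\<close>, so a bound on the number of
  bits can serve as the number of iterations.\<close>

definition run :: "protocol \<Rightarrow> (nat \<Rightarrow> edges) \<Rightarrow> nat \<Rightarrow> transcript" where
  "run \<pi> E n = (step \<pi> E ^^ n) []"

lemma run_0 [simp]: "run \<pi> E 0 = []"
  and run_Suc [simp]: "run \<pi> E (Suc n) = step \<pi> E (run \<pi> E n)"
  by (simp_all add: run_def)

lemma reachable_run: "reachable \<pi> E (run \<pi> E n)"
  by (induction n) (auto simp: step_def intro: reachable.intros split: action.split)

lemma run_length_reachable: "reachable \<pi> E t \<Longrightarrow> run \<pi> E (length t) = t"
  by (induction rule: reachable.induct) (auto simp: step_def)

lemma length_run_le: "length (run \<pi> E n) \<le> n"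
  by (induction n) (auto simp: step_def split: action.split)

lemma prefix_run: "m \<le> n \<Longrightarrow> prefix (run \<pi> E m) (run \<pi> E n)"
proof (induction n rule: dec_induct)
  case (step n)
  then show ?case
    by (auto simp: step_def prefix_def split: action.split)
qed simp

lemma run_stuck:
  assumes "fst \<pi> (run \<pi> E m) = Output H" "m \<le> n"
  shows "run \<pi> E n = run \<pi> E m"
  using assms(2)
proof (induction n rule: dec_induct)
  case (step n)
  then show ?case using assms(1) by (simp add: step_def)
qed simp

lemma length_run_not_Output:
  "(\<And>H. fst \<pi> (run \<pi> E n) \<noteq> Output H) \<Longrightarrow> length (run \<pi> E (Suc n)) = Suc n"
proof (induction n)
  case 0
  then show ?case by (auto simp: step_def split: action.split)
next
  case (Suc n)
  have "fst \<pi> (run \<pi> E n) \<noteq> Output H" for H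
    using Suc.prems[of H] run_stuck[of \<pi> E n H "Suc n"] by (metis le_SucI order_refl)
  then have "length (run \<pi> E (Suc n)) = Suc n" by (rule Suc.IH)
  then show ?case
    using Suc.prems by (auto simp: step_def[of _ _ "run \<pi> E (Suc n)"] simp del: run_Suc
        simp: run_Suc[of _ _ "Suc n"] split: action.split)
qed

text \<open>The value \<open>{}\<close> of an unfinished run is a default; it cannot arise when at
  most \<open>T\<close> bits are exchanged.\<close>

definition outcome :: "protocol \<Rightarrow> nat \<Rightarrow> (nat \<Rightarrow> edges) \<Rightarrow> edges" where
  "outcome \<pi> T E = (case fst \<pi> (run \<pi> E T) of Output H \<Rightarrow> H | _ \<Rightarrow> {})"

lemma outputs_iff_outcome:
  assumes "bits_exchanged \<pi> E \<le> enat T"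
  shows "outputs \<pi> E H \<longleftrightarrow> H = outcome \<pi> T E"
proof -
  have le: "length t \<le> T" if "reachable \<pi> E t" for t
  proof -
    have "enat (length t) \<le> bits_exchanged \<pi> E"
      unfolding bits_exchanged_def using that by (intro SUP_upper) simp
    then show ?thesis using assms by (metis enat_ord_simps(1) order.trans)
  qed
  \<comment> \<open>A run still going after \<open>T\<close> steps would reach a transcript of
    length \<open>Suc T\<close>.\<close>
  obtain H' where H': "fst \<pi> (run \<pi> E T) = Output H'"
    using le[OF reachable_run[of \<pi> E "Suc T"]] length_run_not_Output[of \<pi> E T] by fastforce
  have "outputs \<pi> E H \<longleftrightarrow> H = H'"
  proof
    assume "outputs \<pi> E H"
    then obtain t where t: "reachable \<pi> E t" "fst \<pi> t = Output H" by (auto simp: outputs_def)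
    then have "run \<pi> E T = t"
      using run_stuck[of \<pi> E "length t" H T] le[OF t(1)] by (simp add: run_length_reachable)
    then show "H = H'" using t H' by simp
  qed (use H' reachable_run in \<open>unfold outputs_def, blast\<close>)
  then show ?thesis by (simp add: outcome_def H')
qed

section \<open>The rectangle property of a player's view\<close>

definition consistent :: "protocol \<Rightarrow> nat \<Rightarrow> edges \<Rightarrow> transcript \<Rightarrow> bool" where
  "consistent \<pi> i x v \<longleftrightarrow> (\<forall>p b q. v = p @ From_Player i b # q \<longrightarrow> b = snd \<pi> i x p)"

lemma consistent_Nil: "consistent \<pi> i x []"
  by (simp add: consistent_def)

lemma consistent_snoc:
  "consistent \<pi> i x v \<Longrightarrow> (\<And>b. m = From_Player i b \<Longrightarrow> b = snd \<pi> i x v) \<Longrightarrow> consistent \<pi> i x (v @ [m])"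
  unfolding consistent_def
proof (intro allI impI)
  fix p b q
  assume *: "\<forall>p b q. v = p @ From_Player i b # q \<longrightarrow> b = snd \<pi> i x p"
    "\<And>b. m = From_Player i b \<Longrightarrow> b = snd \<pi> i x v" "v @ [m] = p @ From_Player i b # q"
  show "b = snd \<pi> i x p"
    using * by (cases q rule: rev_cases) auto
qed

lemma consistent_run: "consistent \<pi> i (E i) (player_view i (run \<pi> E n))"
proof (induction n)
  case 0
  then show ?case by (simp add: player_view_def consistent_Nil)
next
  case (Suc n)
  have "consistent \<pi> i (E i) (player_view i (run \<pi> E n) @ [m])"
    if "m = To_Player i b \<or> m = From_Player i (snd \<pi> i (E i) (player_view i (run \<pi> E n)))" for m b
    using that by (intro consistent_snoc Suc) auto
  then show ?case
    using Suc by (auto simp: step_def player_view_def split: action.split)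
qed

text \<open>The input of player \<open>i\<close> enters a run only through the bits that
  \<open>i\<close> sends, and consistency says that \<open>x\<close> yields the same bits after the
  same prefixes of the view. This gives transcript probabilities their product form.\<close>

lemma run_fun_upd_consistent:
  assumes "consistent \<pi> i x (player_view i (run \<pi> E T))" "n \<le> T"
  shows "run \<pi> (E(i := x)) n = run \<pi> E n"
  using assms(2)
proof (induction n)
  case (Suc n)
  let ?t = "run \<pi> E n"
  have "step \<pi> (E(i := x)) ?t = step \<pi> E ?t"
  proof (cases "fst \<pi> ?t = Receive i")
    case True
    let ?b = "snd \<pi> i (E i) (player_view i ?t)"
    have "prefix (?t @ [From_Player i ?b]) (run \<pi> E T)"
      using prefix_run[OF Suc.prems, of \<pi> E] True by (simp add: step_def)
    then obtain r where "run \<pi> E T = ?t @ From_Player i ?b # r"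
      by (auto simp: prefix_def)
    then have "player_view i (run \<pi> E T) = player_view i ?t @ From_Player i ?b # player_view i r"
      by (simp add: player_view_def)
    then have "?b = snd \<pi> i x (player_view i ?t)"
      using assms(1) unfolding consistent_def by metis
    then show ?thesis using True by (simp add: step_def)
  qed (auto simp: step_def split: action.split)
  then show ?case unfolding run_Suc using Suc.IH Suc.prems by (metis Suc_leD)
qed simp

section \<open>Lengths of views\<close>

definition views :: "nat \<Rightarrow> nat \<Rightarrow> transcript set" where
  "views i T = {v. set v \<subseteq> {m. partner m = i} \<and> length v \<le> T}"

lemma messages_of_player:
  "{m. partner m = i} = {To_Player i True, To_Player i False, From_Player i True, From_Player i False}"
proof -
  have "m \<in> {To_Player i True, To_Player i False, From_Player i True, From_Player i False}"
    if "partner m = i" for m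
    using that by (cases m) auto
  then show ?thesis by auto
qed

lemma finite_views: "finite (views i T)"
  unfolding views_def messages_of_player by (rule finite_lists_length_le) simp

lemma player_view_in_views: "player_view i (run \<pi> E T) \<in> views i T"
  by (auto simp: views_def player_view_def intro: order.trans[OF length_filter_le length_run_le])

lemma sum_length_player_view_le: "(\<Sum>i<s. length (player_view i t)) \<le> length t"
proof (induction t)
  case (Cons m t)
  have "(\<Sum>i<s. length (player_view i (m # t)))
      = (\<Sum>i<s. of_bool (partner m = i)) + (\<Sum>i<s. length (player_view i t))"
    unfolding sum.distrib[symmetric] by (intro sum.cong) (auto simp: player_view_def)
  also have "(\<Sum>i<s. of_bool (partner m = i) :: nat) \<le> 1"
    by (simp add: of_bool_def sum.delta)
  finally show ?case using Cons by simp
qed (simp add: player_view_def)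

text \<open>There are \<open>4 ^ l\<close> lists of length \<open>l\<close>, so this length has
  total weight \<open>(1 / 2) ^ l / 2\<close>. This is the \<open>q\<close> of the Gibbs
  inequality.\<close>

lemma sum_views_weight_le: "(\<Sum>v\<in>views i T. (1 / 8) ^ length v / 2) \<le> (1 :: real)"
proof -
  have "(\<Sum>v\<in>views i T. (1 / 8) ^ length v / 2) = (1 - (1 / 2) ^ Suc T :: real)"
  proof (induction T)
    case 0
    have "views i 0 = {[]}" by (auto simp: views_def)
    then show ?case by simp
  next
    case (Suc T)
    let ?L = "{v. set v \<subseteq> {m. partner m = i} \<and> length v = Suc T}"
    have fin: "finite ?L" and card: "card ?L = 4 ^ Suc T"
      unfolding messages_of_player
      by (rule finite_lists_length_eq, simp)
        (subst card_lists_length_eq, simp_all add: numeral_eq_Suc)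
    have "views i (Suc T) = views i T \<union> ?L" "views i T \<inter> ?L = {}" by (auto simp: views_def)
    then have "(\<Sum>v\<in>views i (Suc T). (1 / 8) ^ length v / 2)
        = (\<Sum>v\<in>views i T. (1 / 8) ^ length v / 2) + (\<Sum>v\<in>?L. (1 / 8) ^ length v / 2 :: real)"
      using fin finite_views by (simp add: sum.union_disjoint)
    also have "(\<Sum>v\<in>?L. (1 / 8) ^ length v / 2 :: real) = (\<Sum>v\<in>?L. (1 / 8) ^ Suc T / 2)"
      by (intro sum.cong) auto
    also have "\<dots> = 4 ^ Suc T * (1 / 8) ^ Suc T / 2"
      unfolding sum_constant card by simp
    also have "\<dots> = (1 / 2) ^ Suc T / 2"
      by (simp only: power_mult_distrib[symmetric]) simp
    finally show ?case using Suc by simp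
  qed
  then show ?thesis by simp
qed

section \<open>Symmetrization\<close>

text \<open>The law of a random subset of \<open>D\<close> that contains each element independently
  with probability 1 / 3.\<close>

definition subset_weight :: "'a set \<Rightarrow> 'a set \<Rightarrow> real" where
  "subset_weight D x = 2 ^ card (D - x) / 3 ^ card D"

definition inputs_weight :: "nat set \<Rightarrow> 'a set \<Rightarrow> (nat \<Rightarrow> 'a set) \<Rightarrow> real" where
  "inputs_weight I D X = (\<Prod>l\<in>I. subset_weight D (X l))"

text \<open>Independent inputs for the players in \<open>I\<close>; the input of a player outside
  \<open>I\<close> is supplied by an update \<open>X(i := x)\<close>.\<close>

definition expect :: "nat set \<Rightarrow> 'a set \<Rightarrow> ((nat \<Rightarrow> 'a set) \<Rightarrow> real) \<Rightarrow> real" where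
  "expect I D F = (\<Sum>X\<in>PiE I (\<lambda>_. Pow D). inputs_weight I D X * F X)"

lemma inputs_weight_nonneg: "0 \<le> inputs_weight I D X"
  by (simp add: inputs_weight_def subset_weight_def prod_nonneg)

lemma sum_subset_weight:
  assumes "finite D" shows "(\<Sum>x\<in>Pow D. subset_weight D x) = 1"
proof -
  have "(\<Sum>x\<in>Pow D. 2 ^ card (D - x)) = (\<Sum>x\<in>Pow D. 2 ^ card x :: real)"
    by (rule sum.reindex_bij_witness[where i="\<lambda>x. D - x" and j="\<lambda>x. D - x"]) (auto simp: double_diff)
  then show ?thesis
    using assms by (simp add: subset_weight_def sum_power_card_Pow flip: sum_divide_distrib)
qed

lemma expect_const:
  assumes "finite I" "finite D" shows "expect I D (\<lambda>_. c) = c"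
proof -
  have "(\<Sum>X\<in>PiE I (\<lambda>_. Pow D). inputs_weight I D X) = 1"
    unfolding inputs_weight_def using assms
    by (subst prod_sum_PiE[symmetric]) (auto simp: sum_subset_weight)
  then show ?thesis by (simp add: expect_def flip: sum_distrib_right)
qed

lemma expect_mono: "(\<And>X. X \<in> PiE I (\<lambda>_. Pow D) \<Longrightarrow> F X \<le> G X) \<Longrightarrow> expect I D F \<le> expect I D G"
  unfolding expect_def by (intro sum_mono mult_left_mono inputs_weight_nonneg) auto

lemma expect_sum: "expect I D (\<lambda>X. \<Sum>i\<in>K. F i X) = (\<Sum>i\<in>K. expect I D (F i))"
  unfolding expect_def by (subst sum.swap) (simp add: sum_distrib_left)

lemma expect_cmult: "expect I D (\<lambda>X. c * F X) = c * expect I D F"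
  by (simp add: expect_def sum_distrib_left mult_ac)

lemma expect_nonneg: "(\<And>X. 0 \<le> F X) \<Longrightarrow> 0 \<le> expect I D F"
  unfolding expect_def by (intro sum_nonneg mult_nonneg_nonneg inputs_weight_nonneg)

lemma expect_cong: "(\<And>X. X \<in> PiE I (\<lambda>_. Pow D) \<Longrightarrow> F X = G X) \<Longrightarrow> expect I D F = expect I D G"
  unfolding expect_def by (intro sum.cong) auto

lemma expect_insert:
  assumes "finite I" "i \<notin> I" "finite D"
  shows "expect (insert i I) D F
    = (\<Sum>x\<in>Pow D. subset_weight D x * expect I D (\<lambda>X. F (X(i := x))))"
proof -
  have w: "inputs_weight (insert i I) D (X(i := x)) = subset_weight D x * inputs_weight I D X" for X x
  proof -
    have "(\<Prod>l\<in>I. subset_weight D ((X(i := x)) l)) = (\<Prod>l\<in>I. subset_weight D (X l))"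
      using assms by (intro prod.cong) auto
    then show ?thesis using assms by (simp add: inputs_weight_def)
  qed
  have "expect (insert i I) D F
      = (\<Sum>(x, X)\<in>Pow D \<times> PiE I (\<lambda>_. Pow D). inputs_weight (insert i I) D (X(i := x)) * F (X(i := x)))"
    unfolding expect_def PiE_insert_eq using inj_combinator[OF assms(2), of "\<lambda>_. Pow D"]
    by (subst sum.reindex) (simp_all add: case_prod_unfold)
  also have "\<dots> = (\<Sum>x\<in>Pow D. \<Sum>X\<in>PiE I (\<lambda>_. Pow D). subset_weight D x * (inputs_weight I D X * F (X(i := x))))"
    by (simp add: w sum.cartesian_product mult.assoc)
  finally show ?thesis by (simp add: expect_def sum_distrib_left)
qed

text \<open>
  The left-hand side puts every coordinate into \<open>A\<close> or its complement at random and then draws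
  \<open>x\<close> and \<open>y\<close> uniformly from the two parts. The right-hand side shows that, given \<open>D = J - y\<close>,
  the set \<open>x\<close> then has density \<open>1 / 3\<close> in \<open>D\<close>; hence all players can be given the same law.
\<close>

lemma avg_disjoint_pair:
  assumes J: "finite J"
  shows "avg J (\<lambda>A. avg A (\<lambda>x. avg (J - A) (\<lambda>y. f x y)))
    = (\<Sum>y\<in>Pow J. 3 ^ card (J - y) / 4 ^ card J * (\<Sum>x\<in>Pow (J - y). subset_weight (J - y) x * f x y))"
proof -
  have fin: "finite B" if "B \<subseteq> J" for B using that J finite_subset by auto
  have card: "(2 :: real) ^ card A * 2 ^ card (J - A) = 2 ^ card J" if "A \<subseteq> J" for A
    using that J fin[OF that] by (simp add: card_Diff_subset card_mono flip: power_add)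
  have four: "(2 :: real) ^ card J * 2 ^ card J = 4 ^ card J"
    by (simp flip: power_mult_distrib)
  have "avg J (\<lambda>A. avg A (\<lambda>x. avg (J - A) (\<lambda>y. f x y)))
      = avg J (\<lambda>A. (\<Sum>y\<in>Pow (J - A). \<Sum>x\<in>Pow A. f x y) / 2 ^ card J)"
  proof (intro avg_cong)
    fix A assume A: "A \<subseteq> J"
    have "avg A (\<lambda>x. avg (J - A) (\<lambda>y. f x y)) = (\<Sum>x\<in>Pow A. \<Sum>y\<in>Pow (J - A). f x y) / 2 ^ card J"
      unfolding avg_def card[OF A, symmetric] by (simp add: mult.commute flip: sum_divide_distrib)
    also have "(\<Sum>x\<in>Pow A. \<Sum>y\<in>Pow (J - A). f x y) = (\<Sum>y\<in>Pow (J - A). \<Sum>x\<in>Pow A. f x y)"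
      by (rule sum.swap)
    finally show "avg A (\<lambda>x. avg (J - A) (\<lambda>y. f x y)) = (\<Sum>y\<in>Pow (J - A). \<Sum>x\<in>Pow A. f x y) / 2 ^ card J" .
  qed
  also have "\<dots> = (\<Sum>A\<in>Pow J. \<Sum>y\<in>Pow (J - A). \<Sum>x\<in>Pow A. f x y) / 4 ^ card J"
    by (simp add: avg_def flip: four sum_divide_distrib)
  also have "(\<Sum>A\<in>Pow J. \<Sum>y\<in>Pow (J - A). \<Sum>x\<in>Pow A. f x y)
      = (\<Sum>(A, y)\<in>Sigma (Pow J) (\<lambda>A. Pow (J - A)). \<Sum>x\<in>Pow A. f x y)"
    using fin J by (subst sum.Sigma) auto
  also have "\<dots> = (\<Sum>(y, A)\<in>Sigma (Pow J) (\<lambda>y. Pow (J - y)). \<Sum>x\<in>Pow A. f x y)"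
    by (rule sum.reindex_bij_witness[where i="\<lambda>(y, A). (A, y)" and j="\<lambda>(A, y). (y, A)"]) auto
  also have "\<dots> = (\<Sum>y\<in>Pow J. \<Sum>A\<in>Pow (J - y). \<Sum>x\<in>Pow A. f x y)"
    using fin J by (subst sum.Sigma) auto
  \<comment> \<open>Given \<open>x\<close> and \<open>y\<close>, the hidden \<open>A\<close> is any
    set between \<open>x\<close> and \<open>J - y\<close>.\<close>
  also have "\<dots> = (\<Sum>y\<in>Pow J. \<Sum>x\<in>Pow (J - y). 2 ^ card (J - y - x) * f x y)"
  proof (rule sum.cong[OF refl])
    fix y
    define D where "D = J - y"
    have D: "finite D" using J by (simp add: D_def)
    then have finD: "finite B" if "B \<subseteq> D" for B using that finite_subset by auto
    have "(\<Sum>A\<in>Pow D. \<Sum>x\<in>Pow A. f x y) = (\<Sum>(A, x)\<in>Sigma (Pow D) Pow. f x y)"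
      using D finD by (subst sum.Sigma) auto
    also have "\<dots> = (\<Sum>(x, C)\<in>Sigma (Pow D) (\<lambda>x. Pow (D - x)). f x y)"
      by (rule sum.reindex_bij_witness[where i="\<lambda>(x, C). (x \<union> C, x)" and j="\<lambda>(A, x). (x, A - x)"]) auto
    also have "\<dots> = (\<Sum>x\<in>Pow D. \<Sum>C\<in>Pow (D - x). f x y)"
      using D finD by (subst sum.Sigma) auto
    finally show "(\<Sum>A\<in>Pow (J - y). \<Sum>x\<in>Pow A. f x y) = (\<Sum>x\<in>Pow (J - y). 2 ^ card (J - y - x) * f x y)"
      using D by (simp add: D_def card_Pow)
  qed
  also have "\<dots> / 4 ^ card J
      = (\<Sum>y\<in>Pow J. 3 ^ card (J - y) / 4 ^ card J * (\<Sum>x\<in>Pow (J - y). subset_weight (J - y) x * f x y))"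
    by (simp add: sum_divide_distrib sum_distrib_left subset_weight_def)
  finally show ?thesis .
qed

section \<open>Summing over the players\<close>

definition others :: "nat \<Rightarrow> nat \<Rightarrow> nat set" where
  "others s i = {..<s} - {i}"

text \<open>By \<open>avg_disjoint_pair\<close>, adding \<open>x\<close> as the input of
  \<open>i\<close> gives a family whose law does not depend on \<open>i\<close>. So the sum over
  \<open>i\<close> moves inside the expectation, where the pointwise bound applies. It is meant for
  lengths of views.\<close>

lemma sum_avg_disjoint_pair_le:
  assumes J: "finite J"
    and F: "\<And>X. (\<Sum>i<s. F i X) \<le> (T :: real)"
  shows "(\<Sum>i<s. avg J (\<lambda>A. avg A (\<lambda>x. avg (J - A) (\<lambda>y. expect (others s i) (J - y) (\<lambda>X. F i (X(i := x)))))))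
    \<le> T"
proof -
  have "avg J (\<lambda>A. avg A (\<lambda>x. avg (J - A) (\<lambda>y. expect (others s i) (J - y) (\<lambda>X. F i (X(i := x))))))
      = (\<Sum>y\<in>Pow J. 3 ^ card (J - y) / 4 ^ card J * expect {..<s} (J - y) (F i))" if "i < s" for i
  proof -
    have ins: "insert i (others s i) = {..<s}" using that by (auto simp: others_def)
    have "(\<Sum>x\<in>Pow (J - y). subset_weight (J - y) x * expect (others s i) (J - y) (\<lambda>X. F i (X(i := x))))
        = expect {..<s} (J - y) (F i)" for y
      using J expect_insert[of "others s i" i "J - y" "F i"] unfolding ins by (simp add: others_def)
    then show ?thesis
      using avg_disjoint_pair[OF J, of "\<lambda>x y. expect (others s i) (J - y) (\<lambda>X. F i (X(i := x)))"] by simp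
  qed
  then have "(\<Sum>i<s. avg J (\<lambda>A. avg A (\<lambda>x. avg (J - A) (\<lambda>y. expect (others s i) (J - y) (\<lambda>X. F i (X(i := x)))))))
      = (\<Sum>i<s. \<Sum>y\<in>Pow J. 3 ^ card (J - y) / 4 ^ card J * expect {..<s} (J - y) (F i))"
    by simp
  also have "\<dots> = (\<Sum>y\<in>Pow J. 3 ^ card (J - y) / 4 ^ card J * expect {..<s} (J - y) (\<lambda>X. \<Sum>i<s. F i X))"
    by (subst sum.swap) (simp add: expect_sum sum_distrib_left)
  also have "\<dots> \<le> (\<Sum>y\<in>Pow J. 3 ^ card (J - y) / 4 ^ card J * expect {..<s} (J - y) (\<lambda>_. T))"
    by (intro sum_mono mult_left_mono expect_mono F) auto
  also have "\<dots> = (\<Sum>y\<in>Pow J. 3 ^ card (J - y)) / 4 ^ card J * T"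
    using J by (simp add: expect_const sum_distrib_right sum_divide_distrib)
  also have "(\<Sum>y\<in>Pow J. 3 ^ card (J - y)) = (\<Sum>y\<in>Pow J. 3 ^ card y :: real)"
    by (rule sum.reindex_bij_witness[where i="\<lambda>x. J - x" and j="\<lambda>x. J - x"]) (auto simp: double_diff)
  also have "\<dots> / 4 ^ card J * T = T"
    using J by (simp add: sum_power_card_Pow)
  finally show ?thesis .
qed

text \<open>
  How much better \<open>P X j\<close> (the probability of declaring \<open>j\<close> absent on input \<open>X\<close>) is when player
  \<open>i\<close> lacks \<open>j\<close> than when \<open>i\<close> is the only player holding it, summed over \<open>j\<close>.
\<close>

definition advantage :: "nat \<Rightarrow> 'a set \<Rightarrow> nat \<Rightarrow> ((nat \<Rightarrow> 'a set) \<Rightarrow> 'a \<Rightarrow> real) \<Rightarrow> real" where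
  "advantage s J i P = (\<Sum>j\<in>J. avg (J - {j}) (\<lambda>A. avg A (\<lambda>x. avg (J - {j} - A) (\<lambda>y.
     expect (others s i) (J - insert j y) (\<lambda>X. P (X(i := x)) j)
     - expect (others s i) (J - insert j y) (\<lambda>X. P (X(i := insert j x)) j)))))"

text \<open>For fixed inputs of the others, \<open>x\<close> produces the view \<open>v\<close> iff
  \<open>v\<close> is consistent with \<open>x\<close> and some input of \<open>i\<close> produces
  \<open>v\<close>; the whole run, and with it \<open>Q\<close>, is then the same. So the weight of
  \<open>v\<close> splits into a factor for \<open>x\<close> and a factor for the others.\<close>

lemma rectangle_sum:
  fixes f :: "transcript \<Rightarrow> real"
  shows "(\<Sum>v\<in>views i T. of_bool (consistent \<pi> i x v)
      * expect I D (\<lambda>X. of_bool (\<exists>x'. player_view i (run \<pi> (X(i := x')) T) = v \<and> Q (run \<pi> (X(i := x')) T))) * f v)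
    = expect I D (\<lambda>X. of_bool (Q (run \<pi> (X(i := x)) T)) * f (player_view i (run \<pi> (X(i := x)) T)))"
proof -
  let ?v = "\<lambda>X x. player_view i (run \<pi> (X(i := x)) T)"
  have *: "of_bool (consistent \<pi> i x v) * of_bool (\<exists>x'. ?v X x' = v \<and> Q (run \<pi> (X(i := x')) T))
      = (of_bool (?v X x = v \<and> Q (run \<pi> (X(i := x)) T)) :: real)" for X v
  proof -
    have "run \<pi> (X(i := x)) T = run \<pi> (X(i := x')) T" if "consistent \<pi> i x (?v X x')" for x'
      using run_fun_upd_consistent[OF that order.refl] by (simp only: fun_upd_upd)
    moreover have "consistent \<pi> i x (?v X x)"
      using consistent_run[of \<pi> i "X(i := x)" T] by (simp only: fun_upd_same)
    ultimately have "consistent \<pi> i x v \<and> (\<exists>x'. ?v X x' = v \<and> Q (run \<pi> (X(i := x')) T))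
        \<longleftrightarrow> ?v X x = v \<and> Q (run \<pi> (X(i := x)) T)"
      by metis
    then show ?thesis
      unfolding of_bool_conj[symmetric] by (rule arg_cong)
  qed
  have "(\<Sum>v\<in>views i T. of_bool (consistent \<pi> i x v)
      * expect I D (\<lambda>X. of_bool (\<exists>x'. ?v X x' = v \<and> Q (run \<pi> (X(i := x')) T))) * f v)
      = (\<Sum>v\<in>views i T. expect I D (\<lambda>X. f v * of_bool (?v X x = v \<and> Q (run \<pi> (X(i := x)) T))))"
    unfolding *[symmetric] expect_cmult by (intro sum.cong refl) (simp only: mult_ac)
  also have "\<dots> = expect I D (\<lambda>X. \<Sum>v\<in>views i T. f v * of_bool (?v X x = v \<and> Q (run \<pi> (X(i := x)) T)))"
    unfolding expect_sum ..
  also have "\<dots> = expect I D (\<lambda>X. of_bool (Q (run \<pi> (X(i := x)) T)) * f (?v X x))"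
  proof (intro expect_cong)
    fix X
    have "(\<Sum>v\<in>views i T. f v * of_bool (?v X x = v \<and> Q (run \<pi> (X(i := x)) T)))
        = (\<Sum>v\<in>views i T. if ?v X x = v then f v * of_bool (Q (run \<pi> (X(i := x)) T)) else 0)"
      by (intro sum.cong) auto
    also have "\<dots> = f (?v X x) * of_bool (Q (run \<pi> (X(i := x)) T))"
      unfolding sum.delta'[OF finite_views] if_P[OF player_view_in_views] ..
    finally show "(\<Sum>v\<in>views i T. f v * of_bool (?v X x = v \<and> Q (run \<pi> (X(i := x)) T)))
        = of_bool (Q (run \<pi> (X(i := x)) T)) * f (?v X x)" by (simp only: mult.commute)
  qed
  finally show ?thesis .
qed

text \<open>Player \<open>i\<close> is the first party; the others together form the second, with
  their inputs averaged out given \<open>y\<close>. With \<theta> equal to 1 / 6 the entropy has the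
  factor \<open>96 * 6 = 576\<close>, and every message in the view costs
  \<open>3 * 576 = 1728\<close>.\<close>

lemma advantage_le:
  fixes \<pi> :: protocol and J :: edges and T s i :: nat
  assumes J: "finite J"
  defines "P \<equiv> \<lambda>X j. of_bool (j \<notin> outcome \<pi> T X)"
  shows "advantage s J i P \<le> card J / 6 + 576 + 1728 * avg J (\<lambda>A. avg A (\<lambda>x. avg (J - A) (\<lambda>y.
    expect (others s i) (J - y) (\<lambda>X. real (length (player_view i (run \<pi> (X(i := x)) T)))))))"
proof -
  define V where "V = views i T"
  define I where "I = others s i"
  define a where "a v x = (of_bool (consistent \<pi> i x v) :: real)" for v x
  \<comment> \<open>The conjunct \<open>True\<close> makes this the instance of
    \<open>rectangle_sum\<close> with trivial \<open>Q\<close>.\<close>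
  define b where "b v y = expect I (J - y)
    (\<lambda>X. of_bool (\<exists>x'. player_view i (run \<pi> (X(i := x')) T) = v \<and> True))" for v y
  \<comment> \<open>An unfinished run counts as declaring \<open>j\<close> absent, in agreement with
    the default of \<open>outcome\<close>.\<close>
  define z where "z j v y = expect I (J - y) (\<lambda>X. of_bool (\<exists>x'. player_view i (run \<pi> (X(i := x')) T) = v \<and>
      (case fst \<pi> (run \<pi> (X(i := x')) T) of Output H \<Rightarrow> j \<notin> H | _ \<Rightarrow> True)))" for j v y
  have finI: "finite I" by (simp add: I_def others_def)
  have ab: "(\<Sum>v\<in>V. a v x * b v y * f v) = expect I (J - y) (\<lambda>X. f (player_view i (run \<pi> (X(i := x)) T)))" for x y f
    unfolding a_def b_def V_def by (subst rectangle_sum) simp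
  have az: "(\<Sum>v\<in>V. a v x * z j v y) = expect I (J - y) (\<lambda>X. P (X(i := x)) j)" for x y j
  proof -
    have "P X j = of_bool (case fst \<pi> (run \<pi> X T) of Output H \<Rightarrow> j \<notin> H | _ \<Rightarrow> True)" for X
      by (simp add: P_def outcome_def split: action.split)
    then show ?thesis
      unfolding a_def z_def V_def using rectangle_sum[where f="\<lambda>_. 1"] by simp
  qed
  interpret two_party J V a b
  proof
    show "(\<Sum>v\<in>V. a v x * b v y) = 1" for x y
      using ab[of x y "\<lambda>_. 1"] J finI by (simp add: expect_const)
  qed (use J finite_views in \<open>auto simp: V_def a_def b_def intro!: expect_nonneg\<close>)
  define q where "q v = (1 / 8) ^ length v / (2 :: real)" for v :: transcript
  define \<l> where "\<l> x y = expect I (J - y) (\<lambda>X. real (length (player_view i (run \<pi> (X(i := x)) T))))" for x y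
  \<comment> \<open>\<open>1 / q v\<close> equals \<open>2 * 8 ^ length v\<close>, and
    \<open>ln 2\<close> is below 1.\<close>
  have lnq: "ln (1 / q v) \<le> 1 + 3 * real (length v)" for v
  proof -
    have "ln (1 / q v) = (1 + 3 * real (length v)) * ln 2"
      using ln_realpow[of 8 "length v"] ln_realpow[of 2 3]
      by (simp add: q_def power_divide ln_div ln_mult algebra_simps)
    also have "\<dots> \<le> (1 + 3 * real (length v)) * 1"
      using ln2_le_25_over_36 by (intro mult_left_mono) auto
    finally show ?thesis by simp
  qed
  have pl: "(\<Sum>v\<in>V. transcript_prob A v * real (length v)) = avg A (\<lambda>x. avg (J - A) (\<lambda>y. \<l> x y))" for A
  proof -
    have "(\<Sum>v\<in>V. transcript_prob A v * real (length v))
        = avg A (\<lambda>x. avg (J - A) (\<lambda>y. \<Sum>v\<in>V. a v x * b v y * real (length v)))"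
      unfolding avg_sum avg_multc avg_cmult transcript_prob_def ..
    then show ?thesis unfolding ab \<l>_def .
  qed
  have "advantage s J i P = (\<Sum>j\<in>J. avg (J - {j}) (\<lambda>A. \<Sum>v\<in>V. (avg A (a v) - avg A (\<lambda>x. a v (insert j x)))
          * avg (J - {j} - A) (\<lambda>y. z j v (insert j y))))"
  proof -
    have "avg A (\<lambda>x. avg B (\<lambda>y. expect I (J - insert j y) (\<lambda>X. P (X(i := x)) j)
          - expect I (J - insert j y) (\<lambda>X. P (X(i := insert j x)) j)))
        = (\<Sum>v\<in>V. (avg A (a v) - avg A (\<lambda>x. a v (insert j x))) * avg B (\<lambda>y. z j v (insert j y)))" for j A B
      unfolding az[symmetric] avg_diff[symmetric] sum_subtractf[symmetric]
      unfolding left_diff_distrib[symmetric] avg_sum avg_cmult avg_multc ..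
    then show ?thesis by (simp add: advantage_def I_def)
  qed
  also have "\<dots> \<le> 1 / 6 * card J + 96 / (1 / 6) * avg J (\<lambda>A. \<Sum>v\<in>V. transcript_prob A v * ln (1 / q v))"
  proof (rule total_advantage_le)
    show "(\<Sum>v\<in>V. q v) \<le> 1" using sum_views_weight_le by (simp add: V_def q_def)
    show "z j v y \<le> b v y" for j v y
      unfolding z_def b_def by (intro expect_mono) auto
  qed (auto simp: z_def q_def intro!: expect_nonneg)
  also have "avg J (\<lambda>A. \<Sum>v\<in>V. transcript_prob A v * ln (1 / q v))
      \<le> avg J (\<lambda>A. 1 + 3 * avg A (\<lambda>x. avg (J - A) (\<lambda>y. \<l> x y)))"
  proof (intro avg_mono)
    fix A assume "A \<subseteq> J"
    have "(\<Sum>v\<in>V. transcript_prob A v * ln (1 / q v)) \<le> (\<Sum>v\<in>V. transcript_prob A v * (1 + 3 * real (length v)))"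
      by (intro sum_mono mult_left_mono lnq transcript_prob_nonneg)
    also have "\<dots> = (\<Sum>v\<in>V. transcript_prob A v) + 3 * (\<Sum>v\<in>V. transcript_prob A v * real (length v))"
      by (simp add: algebra_simps sum.distrib sum_distrib_left)
    finally show "(\<Sum>v\<in>V. transcript_prob A v * ln (1 / q v)) \<le> 1 + 3 * avg A (\<lambda>x. avg (J - A) (\<lambda>y. \<l> x y))"
      using sum_transcript_prob[OF \<open>A \<subseteq> J\<close>] by (simp add: pl)
  qed
  finally show ?thesis
    using J by (simp add: avg_add avg_cmult avg_const \<l>_def I_def)
qed

text \<open>A message lies in the view of at most one of the players, so the communication term is
  paid once and not once per player.\<close>

lemma sum_advantage_le:
  fixes \<pi> :: protocol and J :: edges
  assumes J: "finite J"
  shows "(\<Sum>i<s. advantage s J i (\<lambda>X j. of_bool (j \<notin> outcome \<pi> T X)))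
    \<le> s * (card J / 6 + 576) + 1728 * real T"
proof -
  let ?W = "\<lambda>i. avg J (\<lambda>A. avg A (\<lambda>x. avg (J - A) (\<lambda>y.
    expect (others s i) (J - y) (\<lambda>X. real (length (player_view i (run \<pi> (X(i := x)) T)))))))"
  have "(\<Sum>i<s. advantage s J i (\<lambda>X j. of_bool (j \<notin> outcome \<pi> T X)))
      \<le> (\<Sum>i<s. (card J / 6 + 576) + 1728 * ?W i)"
    by (intro sum_mono advantage_le J)
  also have "\<dots> = s * (card J / 6 + 576) + 1728 * (\<Sum>i<s. ?W i)"
    by (simp add: sum.distrib sum_distrib_left)
  also have "(\<Sum>i<s. ?W i) \<le> real T"
  proof (rule sum_avg_disjoint_pair_le[OF J])
    fix X
    show "(\<Sum>i<s. real (length (player_view i (run \<pi> X T)))) \<le> real T"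
      using sum_length_player_view_le[where s = s and t = "run \<pi> X T"] length_run_le[of \<pi> X T]
      by (simp flip: of_nat_sum)
  qed
  finally show ?thesis by simp
qed

section \<open>Spanners and girth\<close>

lemma walk_append:
  assumes "walk E u v p" "walk E v w q"
  shows "walk E u w (p @ tl q)"
  using assms by (cases q rule: list.exhaust; cases "tl q")
    (auto simp: walk_def successively_append_iff)

lemma walk_rev: "walk E u v p \<Longrightarrow> walk E v u (rev p)"
  by (auto simp: walk_def hd_rev last_rev successively_rev insert_commute)

lemma walk_mono: "walk E u v p \<Longrightarrow> E \<subseteq> F \<Longrightarrow> walk F u v p"
  unfolding walk_def by (auto elim: successively_mono)

lemma walk_split: "walk E u v (xs @ y # ys) \<longleftrightarrow> walk E u y (xs @ [y]) \<and> walk E y v (y # ys)"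
  by (auto simp: walk_def successively_append_iff hd_append)

lemma walk_distinct:
  "walk E u v p \<Longrightarrow> \<exists>q. walk E u v q \<and> distinct q \<and> length q \<le> length p"
proof (induction "length p" arbitrary: p rule: less_induct)
  case less
  show ?case
  proof (cases "distinct p")
    case False
    then obtain xs ys zs y where p: "p = xs @ [y] @ ys @ [y] @ zs"
      using not_distinct_decomp by blast
    have "walk E u y (xs @ [y])" "walk E y v ((y # ys) @ y # zs)"
      using less.prems unfolding p by (simp_all add: walk_split[of E u v xs])
    then have "walk E u v (xs @ [y] @ zs)"
      unfolding walk_split[of E y v "y # ys"] by (simp add: walk_split[of E u v xs])
    then show ?thesis
      using less.hyps[of "xs @ [y] @ zs"] p by fastforce
  qed (use less.prems in blast)
qed

lemma graph_dist_le: "walk E u v p \<Longrightarrow> length p \<le> Suc l \<Longrightarrow> graph_dist E u v \<le> enat l"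
  unfolding graph_dist_def by (rule INF_lower2[of p]) auto

lemma graph_dist_le_imp_walk:
  assumes "graph_dist E u v \<le> enat l"
  shows "\<exists>p. walk E u v p \<and> length p \<le> Suc l"
proof (rule ccontr)
  assume "\<not> ?thesis"
  then have "enat (Suc l) \<le> graph_dist E u v"
    unfolding graph_dist_def by (intro INF_greatest) (auto simp: not_le)
  with assms have "enat (Suc l) \<le> enat l" by (rule order.trans[rotated])
  then show False by simp
qed

lemma all_edgesE:
  assumes "e \<in> all_edges n"
  obtains u v where "e = {u, v}" "u \<noteq> v" "u < n" "v < n"
  using assms by (auto simp: all_edges_def card_2_iff)

lemma finite_all_edges: "finite (all_edges n)"
  by (rule finite_subset[of _ "Pow {..<n}"]) (auto simp: all_edges_def)

text \<open>A missing edge would be bypassed in \<open>H\<close> by a path on at most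
  \<open>2 * k\<close> vertices, and the edge closes this path to a short cycle in
  \<open>G\<^sub>0\<close>.\<close>

lemma spanner_of_high_girth:
  assumes G: "G \<subseteq> G\<^sub>0" "G\<^sub>0 \<subseteq> all_edges n" and girth: "enat (2 * k) < girth G\<^sub>0"
    and H: "is_spanner (2 * k - 1) n G H"
  shows "H = G"
proof
  show "H \<subseteq> G" using H by (simp add: is_spanner_def)
  show "G \<subseteq> H"
  proof
    fix e assume e: "e \<in> G"
    then obtain u v where uv: "e = {u, v}" "u \<noteq> v" "u < n" "v < n"
      using G all_edgesE by blast
    show "e \<in> H"
    proof (rule ccontr)
      assume "e \<notin> H"
      have "graph_dist G u v \<le> enat 1"
        using e uv by (intro graph_dist_le[of _ _ _ "[u, v]"]) (auto simp: walk_def)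
      then have "enat (2 * k - 1) * graph_dist G u v \<le> enat (2 * k - 1) * enat 1"
        by (intro mult_left_mono) auto
      moreover have "graph_dist H u v \<le> enat (2 * k - 1) * graph_dist G u v"
        using H uv by (simp add: is_spanner_def)
      ultimately have "graph_dist H u v \<le> enat (2 * k - 1)"
        by (simp add: one_enat_def[symmetric])
      from graph_dist_le_imp_walk[OF this] obtain p
        where "walk H u v p" "length p \<le> Suc (2 * k - 1)" by blast
      from walk_distinct[OF this(1)] this(2) obtain q
        where q: "walk H u v q" "distinct q" "length q \<le> Suc (2 * k - 1)" by fastforce
      have "length q \<ge> 3"
      proof (rule ccontr)
        assume "\<not> length q \<ge> 3"
        then consider "q = []" | x where "q = [x]" | x y where "q = [x, y]"
          by (cases q rule: list.exhaust; cases "tl q"; cases "tl (tl q)") auto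
        then show False
          using q(1) uv \<open>e \<notin> H\<close> by cases (auto simp: walk_def)
      qed
      moreover have "successively (\<lambda>x y. {x, y} \<in> G\<^sub>0) q"
        using walk_mono[OF q(1), of G\<^sub>0] H G by (auto simp: walk_def is_spanner_def)
      moreover have "{last q, hd q} \<in> G\<^sub>0"
        using q(1) e uv G by (auto simp: walk_def insert_commute)
      ultimately have "cycle G\<^sub>0 q" using q(2) by (simp add: cycle_def)
      then have "girth G\<^sub>0 \<le> enat (length q)" by (auto simp: girth_def intro: INF_lower)
      \<comment> \<open>For \<open>k = 0\<close> truncated subtraction would give
        \<open>Suc (2 * k - 1) = 1\<close>; the lower bound 3 on the length excludes this.\<close>
      also have "\<dots> \<le> enat (2 * k)" using q(3) \<open>length q \<ge> 3\<close> by simp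
      finally show False using girth by simp
    qed
  qed
qed

section \<open>Spanners from maximal subgraphs without short cycles\<close>

lemma is_spannerI:
  assumes "\<alpha> > 0" "H \<subseteq> G" "G \<subseteq> all_edges n"
    and edge: "\<And>u v. {u, v} \<in> G \<Longrightarrow> \<exists>p. walk H u v p \<and> length p \<le> Suc \<alpha>"
  shows "is_spanner \<alpha> n G H"
proof -
  \<comment> \<open>Replacing every edge of a walk by its substitute in \<open>H\<close> multiplies
    the number of edges by at most \<alpha>.\<close>
  have stretch: "\<exists>q. walk H u v q \<and> length q \<le> Suc (\<alpha> * (length p - 1))" if "walk G u v p" for u v p
    using that
  proof (induction p arbitrary: u)
    case (Cons x p)
    show ?case
    proof (cases p)
      case Nil
      then show ?thesis using Cons.prems by (intro exI[of _ "[u]"]) (auto simp: walk_def)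
    next
      case p: (Cons y p')
      then have xy: "{u, y} \<in> G" and "walk G y v p"
        using Cons.prems by (auto simp: walk_def)
      then obtain q where q: "walk H y v q" "length q \<le> Suc (\<alpha> * (length p - 1))"
        using Cons.IH by blast
      obtain r where r: "walk H u y r" "length r \<le> Suc \<alpha>" using edge[OF xy] by blast
      have "length (r @ tl q) \<le> Suc (\<alpha> * (length (x # p) - 1))"
        using q(2) r(2) p by simp
      then show ?thesis using walk_append[OF r(1) q(1)] by blast
    qed
  qed (simp add: walk_def)
  have "graph_dist H u v \<le> enat \<alpha> * graph_dist G u v" for u v
  proof (cases "graph_dist G u v")
    case (enat d)
    then obtain p where p: "walk G u v p" "length p \<le> Suc d"
      using graph_dist_le_imp_walk[of G u v d] by auto
    then obtain q where q: "walk H u v q" "length q \<le> Suc (\<alpha> * (length p - 1))"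
      using stretch by blast
    have "\<alpha> * (length p - 1) \<le> \<alpha> * d" using p(2) by (intro mult_left_mono) auto
    then have "length q \<le> Suc (\<alpha> * d)" using q(2) by linarith
    from graph_dist_le[OF q(1) this] show ?thesis by (simp add: enat)
  \<comment> \<open>At infinite distance a positive \<alpha> keeps the product infinite, as
    \<open>0 * \<infinity>\<close> is 0 in \<open>enat\<close>.\<close>
  qed (use assms(1) in \<open>simp add: enat_0_iff\<close>)
  then show ?thesis using assms(2) by (simp add: is_spanner_def)
qed

text \<open>Equivalent to the absence of cycles of length at most \<open>2k\<close>, but without cyclic lists.\<close>

definition no_detour :: "nat \<Rightarrow> edges \<Rightarrow> bool" where
  "no_detour k H \<longleftrightarrow> (\<forall>u v p. {u, v} \<in> H \<longrightarrow> walk (H - {{u, v}}) u v p \<longrightarrow> length p > 2 * k)"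

lemma walk_avoiding_edge:
  assumes "walk E u v p" "\<And>p\<^sub>1 p\<^sub>2. p \<noteq> p\<^sub>1 @ [a, b] @ p\<^sub>2" "\<And>p\<^sub>1 p\<^sub>2. p \<noteq> p\<^sub>1 @ [b, a] @ p\<^sub>2"
  shows "walk (E - {{a, b}}) u v p"
proof -
  have "successively (\<lambda>x y. {x, y} \<in> E - {{a, b}}) p" if "successively (\<lambda>x y. {x, y} \<in> E) p"
    "\<And>p\<^sub>1 p\<^sub>2. p \<noteq> p\<^sub>1 @ [a, b] @ p\<^sub>2" "\<And>p\<^sub>1 p\<^sub>2. p \<noteq> p\<^sub>1 @ [b, a] @ p\<^sub>2" for p
    using that
  proof (induction p)
    case (Cons x p)
    show ?case
    proof (cases p)
      case p: (Cons y p')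
      have "p \<noteq> p\<^sub>1 @ [a, b] @ p\<^sub>2" "p \<noteq> p\<^sub>1 @ [b, a] @ p\<^sub>2" for p\<^sub>1 p\<^sub>2
        using Cons.prems(2)[of "x # p\<^sub>1" p\<^sub>2] Cons.prems(3)[of "x # p\<^sub>1" p\<^sub>2] by auto
      then have "successively (\<lambda>x y. {x, y} \<in> E - {{a, b}}) p"
        using Cons.IH Cons.prems(1) p by simp
      moreover have "{x, y} \<noteq> {a, b}"
        using Cons.prems(2)[of "[]" p'] Cons.prems(3)[of "[]" p'] p by (auto simp: doubleton_eq_iff)
      ultimately show ?thesis using Cons.prems(1) p by simp
    qed simp
  qed simp
  then show ?thesis using assms by (simp add: walk_def)
qed

text \<open>Take \<open>H\<close> maximal. Adding a further edge \<open>{a, b}\<close> of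
  \<open>G\<close> creates a short detour. Either it bypasses \<open>{a, b}\<close> itself and lies
  in \<open>H\<close>, or it bypasses an old edge by way of \<open>{a, b}\<close>, and the cycle can
  be opened at \<open>{a, b}\<close> instead.\<close>

lemma exists_maximal_no_detour:
  assumes "G \<subseteq> all_edges n" "k \<ge> 1"
  shows "\<exists>H \<subseteq> G. no_detour k H \<and> (\<forall>u v. {u, v} \<in> G \<longrightarrow> (\<exists>p. walk H u v p \<and> length p \<le> 2 * k))"
proof -
  have "finite {H. H \<subseteq> G \<and> no_detour k H}"
    using assms(1) finite_all_edges finite_subset by fastforce
  moreover have "{} \<in> {H. H \<subseteq> G \<and> no_detour k H}" by (simp add: no_detour_def)
  ultimately obtain H where "H \<in> {H. H \<subseteq> G \<and> no_detour k H}"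
    and "\<forall>H'\<in>{H. H \<subseteq> G \<and> no_detour k H}. H \<subseteq> H' \<longrightarrow> H = H'"
    using finite_has_maximal[of "{H. H \<subseteq> G \<and> no_detour k H}"] by blast
  then have H: "H \<subseteq> G" "no_detour k H"
    and max: "\<And>H'. H' \<subseteq> G \<Longrightarrow> no_detour k H' \<Longrightarrow> H \<subseteq> H' \<Longrightarrow> H' = H"
    by auto
  have "\<exists>p. walk H a b p \<and> length p \<le> 2 * k" if ab: "{a, b} \<in> G" for a b
  proof (cases "{a, b} \<in> H")
    case True
    then have "walk H a b [a, b]" by (simp add: walk_def)
    then show ?thesis using assms(2) by (intro exI[of _ "[a, b]"]) auto
  next
    case False
    have "\<not> no_detour k (insert {a, b} H)"
      using max[of "insert {a, b} H"] ab H(1) False by auto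
    then obtain u v p where uv: "{u, v} \<in> insert {a, b} H"
      and "walk (insert {a, b} H - {{u, v}}) u v p" "length p \<le> 2 * k"
      unfolding no_detour_def not_all not_imp not_less by blast
    then obtain q where q: "walk (insert {a, b} H - {{u, v}}) u v q" "distinct q" "length q \<le> 2 * k"
      using walk_distinct order.trans by blast
    show ?thesis
    proof (cases "{u, v} = {a, b}")
      case True
      then have "walk H u v q" using q(1) by (auto elim: walk_mono)
      with True q(3) walk_rev[OF this] show ?thesis
        by (auto simp: doubleton_eq_iff)
    next
      case uvab: False
      then have uvH: "{u, v} \<in> H" using uv by simp
      \<comment> \<open>The cycle closed by \<open>u\<close>, \<open>v\<close> must use the new edge; opening it there instead gives the walk.\<close>
      have *: "\<exists>p. walk H c d p \<and> length p \<le> 2 * k"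
        if split: "q = q\<^sub>1 @ [c, d] @ q\<^sub>2" and cd: "{c, d} = {a, b}" for c d q\<^sub>1 q\<^sub>2
      proof -
        \<comment> \<open>As \<open>q\<close> is distinct, it uses the new edge only once, so the
          pieces before and after avoid it.\<close>
        have w: "walk (insert {a, b} H - {{u, v}} - {{a, b}}) u c (q\<^sub>1 @ [c])"
        proof (rule walk_avoiding_edge)
          show "walk (insert {a, b} H - {{u, v}}) u c (q\<^sub>1 @ [c])"
            using q(1) split walk_split[of _ u v q\<^sub>1 c "d # q\<^sub>2"] by simp
          have "d \<notin> set (q\<^sub>1 @ [c])" using q(2) split by auto
          then have "\<not> {a, b} \<subseteq> set (q\<^sub>1 @ [c])" unfolding cd[symmetric] by auto
          then show "q\<^sub>1 @ [c] \<noteq> p\<^sub>1 @ [a, b] @ p\<^sub>2" "q\<^sub>1 @ [c] \<noteq> p\<^sub>1 @ [b, a] @ p\<^sub>2" for p\<^sub>1 p\<^sub>2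
            by (metis empty_subsetI in_set_conv_decomp insert_subset append_Cons append_Nil append.assoc)+
        qed
        have w': "walk (insert {a, b} H - {{u, v}} - {{a, b}}) d v (d # q\<^sub>2)"
        proof (rule walk_avoiding_edge)
          show "walk (insert {a, b} H - {{u, v}}) d v (d # q\<^sub>2)"
            using q(1) split walk_split[of _ u v "q\<^sub>1 @ [c]" d "q\<^sub>2"] by simp
          have "c \<notin> set (d # q\<^sub>2)" using q(2) split by auto
          then have "\<not> {a, b} \<subseteq> set (d # q\<^sub>2)" unfolding cd[symmetric] by auto
          then show "d # q\<^sub>2 \<noteq> p\<^sub>1 @ [a, b] @ p\<^sub>2" "d # q\<^sub>2 \<noteq> p\<^sub>1 @ [b, a] @ p\<^sub>2" for p\<^sub>1 p\<^sub>2
            by (metis empty_subsetI in_set_conv_decomp insert_subset append_Cons append_Nil append.assoc)+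
        qed
        have 1: "walk H c u (rev (q\<^sub>1 @ [c]))"
          by (rule walk_mono[OF walk_rev[OF w]]) auto
        have 2: "walk H v d (rev (d # q\<^sub>2))"
          by (rule walk_mono[OF walk_rev[OF w']]) auto
        have "walk H u v [u, v]" using uvH by (simp add: walk_def)
        from walk_append[OF walk_append[OF 1 this] 2]
        have "walk H c d (rev (q\<^sub>1 @ [c]) @ [v] @ tl (rev (d # q\<^sub>2)))" by simp
        moreover have "length (rev (q\<^sub>1 @ [c]) @ [v] @ tl (rev (d # q\<^sub>2))) \<le> 2 * k"
          using q(3) split by simp
        ultimately show ?thesis by blast
      qed
      show ?thesis
      proof (cases "\<exists>q\<^sub>1 q\<^sub>2. q = q\<^sub>1 @ [a, b] @ q\<^sub>2 \<or> q = q\<^sub>1 @ [b, a] @ q\<^sub>2")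
        case True
        then consider q\<^sub>1 q\<^sub>2 where "q = q\<^sub>1 @ [a, b] @ q\<^sub>2" | q\<^sub>1 q\<^sub>2 where "q = q\<^sub>1 @ [b, a] @ q\<^sub>2" by blast
        then show ?thesis
        proof cases
          case 1
          then show ?thesis using * by blast
        next
          case 2
          then obtain p where "walk H b a p" "length p \<le> 2 * k" using *[OF 2] by (auto simp: insert_commute)
          then show ?thesis using walk_rev[of H b a p] by (metis length_rev)
        qed
      next
        case False
        then have "walk (insert {a, b} H - {{u, v}} - {{a, b}}) u v q"
          by (intro walk_avoiding_edge q) auto
        then have "walk (H - {{u, v}}) u v q" by (rule walk_mono) auto
        then have "length q > 2 * k" using H(2) uvH by (auto simp: no_detour_def)
        then show ?thesis using q(3) by simp
      qed
    qed
  qed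
  then show ?thesis using H by blast
qed

section \<open>The Moore bound\<close>

definition nbrs :: "edges \<Rightarrow> nat \<Rightarrow> nat set" where
  "nbrs H v = {w. {v, w} \<in> H}"

text \<open>Two different such neighbours, joined through \<open>r\<close> and followed by the edge
  from \<open>b\<close> to \<open>v\<close>, would give a detour around \<open>{a, v}\<close> on at
  most \<open>2 * l + 2 \<le> 2 * k\<close> vertices.\<close>

lemma no_detour_unique_parent:
  assumes nd: "no_detour k H" and l: "l < k"
    and far: "\<And>p. walk H r v p \<Longrightarrow> length p > l"
    and ab: "a \<in> nbrs H v" "b \<in> nbrs H v" "a \<noteq> v" "b \<noteq> v"
    and pa: "walk H r a p" "length p \<le> Suc l" and pb: "walk H r b q" "length q \<le> Suc l"
  shows "a = b"
proof (rule ccontr)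
  assume "a \<noteq> b"
  \<comment> \<open>By \<open>far\<close>, such a walk can meet \<open>v\<close> only at its last
    vertex, which is \<open>c\<close>.\<close>
  have notin: "v \<notin> set p" if p: "walk H r c p" "length p \<le> Suc l" "c \<noteq> v" for c p
  proof
    assume "v \<in> set p"
    then obtain xs ys where xy: "p = xs @ v # ys" by (auto dest: split_list)
    have "walk H r v (xs @ [v])"
      using p(1) unfolding xy walk_split[of H r c xs] by simp
    then have "length (xs @ [v]) > l" by (rule far)
    then have "ys = []" using p(2) xy by (cases ys) auto
    then show False using p xy by (simp add: walk_def)
  qed
  let ?w = "rev p @ tl q"
  have w: "walk H a b ?w" using walk_append[OF walk_rev[OF pa(1)] pb(1)] .
  have vw: "v \<notin> set ?w"
    using notin[OF pa ab(3)] notin[OF pb ab(4)] by (cases q) auto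
  have "walk (H - {{a, v}}) a b ?w"
  proof (rule walk_avoiding_edge[OF w])
    show "?w \<noteq> p\<^sub>1 @ [a, v] @ p\<^sub>2" "?w \<noteq> p\<^sub>1 @ [v, a] @ p\<^sub>2" for p\<^sub>1 p\<^sub>2
      using vw by (metis append_Cons in_set_conv_decomp append_Nil append.assoc)+
  qed
  moreover have "walk (H - {{a, v}}) b v [b, v]"
    using ab \<open>a \<noteq> b\<close> by (auto simp: walk_def nbrs_def insert_commute doubleton_eq_iff)
  ultimately have "walk (H - {{a, v}}) a v (?w @ tl [b, v])" by (rule walk_append)
  moreover have "{a, v} \<in> H" using ab by (simp add: nbrs_def insert_commute)
  ultimately have "length (?w @ tl [b, v]) > 2 * k" using nd unfolding no_detour_def by blast
  moreover have "length p > 0" "length q > 0" using pa pb by (auto simp: walk_def)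
  ultimately show False using pa(2) pb(2) l by simp
qed

text \<open>Breadth-first layers from \<open>r\<close>: a vertex of layer \<open>l\<close> has at
  most one neighbour at distance at most \<open>l\<close>, hence at least \<open>d\<close> in the
  next layer, and no vertex there has two parents. So up to depth \<open>k\<close> the layers grow
  by a factor \<open>d\<close>.\<close>

lemma min_degree_bound:
  assumes nd: "no_detour k H" and W: "finite W" "r \<in> W"
    and H: "\<And>e. e \<in> H \<Longrightarrow> e \<subseteq> W" "\<And>v. {v} \<notin> H"
    and deg: "\<And>v. v \<in> W \<Longrightarrow> d < card (nbrs H v)"
  shows "d ^ k \<le> card W"
proof -
  \<comment> \<open>The length of a walk counts vertices, so these are the vertices at distance
    exactly \<open>l\<close>.\<close>
  define L where "L l = {v. (\<exists>p. walk H r v p \<and> length p \<le> Suc l) \<and> (\<forall>p. walk H r v p \<longrightarrow> length p > l)}" for l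
  have walkW: "v \<in> W" if "walk H r v p" for v p
    using that
  proof (induction p arbitrary: v rule: rev_induct)
    case (snoc x p)
    then show ?case
    proof (cases p rule: rev_cases)
      case (snoc p' y)
      then have "walk H y v [y, x]" using snoc.prems walk_split[of H r v p' y "[x]"] by simp
      then have "{y, v} \<in> H" by (auto simp: walk_def)
      then show ?thesis using H by blast
    qed (use W in \<open>auto simp: walk_def\<close>)
  qed (simp add: walk_def)
  have LW: "L l \<subseteq> W" for l by (auto simp: L_def dest: walkW)
  then have finL: "finite (L l)" for l using W finite_subset by blast
  have nbrW: "nbrs H v \<subseteq> W" for v using H by (auto simp: nbrs_def)
  then have finN: "finite (nbrs H v)" for v using W finite_subset by blast
  have nv: "w \<noteq> v" if "w \<in> nbrs H v" for v w using that H(2)[of v] by (auto simp: nbrs_def)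
  have grow: "d * card (L l) \<le> card (L (Suc l))" if l: "l < k" for l
  proof -
    have child: "d \<le> card (nbrs H v \<inter> L (Suc l))" if v: "v \<in> L l" for v
    proof -
      define C where "C = {w \<in> nbrs H v. \<exists>p. walk H r w p \<and> length p \<le> Suc l}"
      have "a = b" if "a \<in> C" "b \<in> C" for a b
        using that v nv no_detour_unique_parent[OF nd l, of r v a b] by (auto simp: C_def L_def)
      moreover have finC: "finite C" using finN by (simp add: C_def)
      ultimately have "card C \<le> 1" by (simp add: card_le_Suc0_iff_eq)
      have "nbrs H v \<subseteq> C \<union> (nbrs H v \<inter> L (Suc l))"
      proof
        fix w assume w: "w \<in> nbrs H v"
        show "w \<in> C \<union> (nbrs H v \<inter> L (Suc l))"
        proof (cases "w \<in> C")
          case False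
          obtain p where p: "walk H r v p" "length p \<le> Suc l" using v by (auto simp: L_def)
          have "walk H v w [v, w]" using w by (simp add: walk_def nbrs_def)
          from walk_append[OF p(1) this] have "walk H r w (p @ [w])" by simp
          moreover have "length (p @ [w]) \<le> Suc (Suc l)" using p by simp
          ultimately have "w \<in> L (Suc l)"
            using False w unfolding L_def C_def by (auto simp: not_le)
          then show ?thesis using w by simp
        qed simp
      qed
      then have "card (nbrs H v) \<le> card (C \<union> (nbrs H v \<inter> L (Suc l)))"
        using finC finN by (intro card_mono) auto
      also have "\<dots> \<le> card C + card (nbrs H v \<inter> L (Suc l))" by (rule card_Un_le)
      finally show ?thesis using deg[of v] v LW \<open>card C \<le> 1\<close> by fastforce
    qed
    have disj: "(nbrs H v \<inter> L (Suc l)) \<inter> (nbrs H w \<inter> L (Suc l)) = {}"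
      if "v \<in> L l" "w \<in> L l" "v \<noteq> w" for v w
    proof -
      have False if x: "x \<in> nbrs H v" "x \<in> nbrs H w" "x \<in> L (Suc l)" for x
      proof -
        have vw: "v \<in> nbrs H x" "w \<in> nbrs H x" using x by (auto simp: nbrs_def insert_commute)
        then have "v \<noteq> x" "w \<noteq> x" using nv by auto
        moreover have "length p > l" if "walk H r x p" for p using x(3) that by (auto simp: L_def)
        ultimately show False
          using no_detour_unique_parent[OF nd l, of r x v w] vw \<open>v \<in> L l\<close> \<open>w \<in> L l\<close> \<open>v \<noteq> w\<close>
          by (auto simp: L_def)
      qed
      then show ?thesis by blast
    qed
    have "d * card (L l) = (\<Sum>v\<in>L l. d)" by simp
    also have "\<dots> \<le> (\<Sum>v\<in>L l. card (nbrs H v \<inter> L (Suc l)))" by (intro sum_mono child)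
    also have "\<dots> = card (\<Union>v\<in>L l. nbrs H v \<inter> L (Suc l))"
      using finL finN disj by (intro card_UN_disjoint[symmetric]) auto
    also have "\<dots> \<le> card (L (Suc l))" using finL by (intro card_mono) auto
    finally show ?thesis .
  qed
  have "d ^ l \<le> card (L l)" if "l \<le> k" for l
    using that
  proof (induction l)
    case 0
    have "walk H r r [r]" by (simp add: walk_def)
    then have "r \<in> L 0" by (fastforce simp: L_def walk_def)
    then show ?case using finL[of 0] by (simp add: card_gt_0_iff Suc_le_eq) blast
  next
    case (Suc l)
    then have "d * d ^ l \<le> d * card (L l)" by (intro mult_left_mono) auto
    also have "\<dots> \<le> card (L (Suc l))" using Suc.prems by (intro grow) auto
    finally show ?case by simp
  qed
  then have "d ^ k \<le> card (L k)" by simp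
  also have "\<dots> \<le> card W" using LW W by (intro card_mono)
  finally show ?thesis .
qed

text \<open>A smallest vertex set inducing more than \<open>d\<close> edges per vertex has minimum
  induced degree above \<open>d\<close>, since deleting a vertex of degree at most \<open>d\<close>
  would preserve the density. It would then need \<open>d ^ k\<close> vertices.\<close>

lemma moore_bound:
  assumes H: "H \<subseteq> all_edges n" "no_detour k H" and d: "n < d ^ k"
  shows "card H \<le> d * n"
proof (rule ccontr)
  assume "\<not> ?thesis"
  define ind where "ind W = {e \<in> H. e \<subseteq> W}" for W
  have finH: "finite H" using H finite_all_edges finite_subset by blast
  have "ind {..<n} = H" using H by (auto simp: ind_def all_edges_def)
  then have "{..<n} \<subseteq> {..<n} \<and> d * card {..<n} < card (ind {..<n})"
    using \<open>\<not> _\<close> by simp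
  from ex_has_least_nat[of "\<lambda>W. W \<subseteq> {..<n} \<and> d * card W < card (ind W)", OF this, of card]
  obtain W where W: "W \<subseteq> {..<n}" "d * card W < card (ind W)"
    and min: "\<And>W'. W' \<subseteq> {..<n} \<Longrightarrow> d * card W' < card (ind W') \<Longrightarrow> card W \<le> card W'"
    by blast
  have finW: "finite W" using W finite_subset by blast
  have fini: "finite (ind U)" for U using finH by (simp add: ind_def)
  have deg: "d < card (nbrs (ind W) v)" if v: "v \<in> W" for v
  proof -
    have "\<not> d * card (W - {v}) < card (ind (W - {v}))"
      using min[of "W - {v}"] W(1) card_Diff1_less[OF finW v] by force
    moreover have "card W = Suc (card (W - {v}))" using card.remove[OF finW v] by simp
    moreover have "card (ind W) \<le> card (ind (W - {v})) + card (nbrs (ind W) v)"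
    proof -
      have "ind W \<subseteq> ind (W - {v}) \<union> (\<lambda>w. {v, w}) ` nbrs (ind W) v"
      proof
        fix e assume e: "e \<in> ind W"
        then obtain x y where xy: "e = {x, y}" using H(1) by (auto simp: ind_def elim!: all_edgesE[OF subsetD])
        show "e \<in> ind (W - {v}) \<union> (\<lambda>w. {v, w}) ` nbrs (ind W) v"
        proof (cases "v \<in> e")
          case True
          then obtain w where "e = {v, w}" using xy by auto
          then show ?thesis using e by (auto simp: nbrs_def)
        qed (use e in \<open>auto simp: ind_def\<close>)
      qed
      moreover have fn: "finite (nbrs (ind W) v)"
        by (rule finite_subset[OF _ finW]) (auto simp: nbrs_def ind_def)
      ultimately have "card (ind W) \<le> card (ind (W - {v}) \<union> (\<lambda>w. {v, w}) ` nbrs (ind W) v)"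
        using fini by (intro card_mono) auto
      also have "\<dots> \<le> card (ind (W - {v})) + card ((\<lambda>w. {v, w}) ` nbrs (ind W) v)" by (rule card_Un_le)
      also have "card ((\<lambda>w. {v, w}) ` nbrs (ind W) v) \<le> card (nbrs (ind W) v)" using fn by (rule card_image_le)
      finally show ?thesis by simp
    qed
    ultimately show ?thesis using W(2) by simp
  qed
  have "ind W \<noteq> {}" using W(2) by auto
  then obtain e where e: "e \<in> ind W" by blast
  then have "e \<subseteq> W" "e \<in> all_edges n" using H(1) by (auto simp: ind_def)
  then obtain r where r: "r \<in> W" by (metis all_edgesE insert_subset)
  have "no_detour k (ind W)"
    unfolding no_detour_def
  proof (intro allI impI)
    fix u v p assume "{u, v} \<in> ind W" "walk (ind W - {{u, v}}) u v p"
    then have "{u, v} \<in> H" "walk (H - {{u, v}}) u v p" by (auto simp: ind_def intro: walk_mono)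
    then show "2 * k < length p" using H(2) by (auto simp: no_detour_def)
  qed
  then have "d ^ k \<le> card W"
  proof (rule min_degree_bound)
    show "{v} \<notin> ind W" for v using H(1) by (auto simp: ind_def all_edges_def)
  qed (use finW r deg in \<open>auto simp: ind_def\<close>)
  also have "\<dots> \<le> n" using card_mono[OF _ W(1)] by simp
  finally show False using d by simp
qed

section \<open>The upper bound\<close>

lemma card_bounded_subsets_le:
  assumes "finite A"
  shows "card {B. B \<subseteq> A \<and> card B \<le> M} \<le> (card A + 1) ^ M"
proof -
  \<comment> \<open>A small set is written as a list and padded with \<open>None\<close> to length
    \<open>M\<close>.\<close>
  let ?X = "insert None (Some ` A)"
  let ?L = "{xs. set xs \<subseteq> ?X \<and> length xs = M}"
  have fin: "finite ?X" using assms by simp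
  have "{B. B \<subseteq> A \<and> card B \<le> M} \<subseteq> (\<lambda>xs. {a. Some a \<in> set xs}) ` ?L"
  proof
    fix B assume B: "B \<in> {B. B \<subseteq> A \<and> card B \<le> M}"
    then have "finite B" using assms finite_subset by blast
    then obtain bs where bs: "set bs = B" "distinct bs" using finite_distinct_list by blast
    then have len: "length bs = card B" using distinct_card[of bs] by simp
    let ?xs = "map Some bs @ replicate (M - card B) None"
    have "B = {a. Some a \<in> set ?xs}" using bs by auto
    moreover have "?xs \<in> ?L" using bs len B by auto
    ultimately show "B \<in> (\<lambda>xs. {a. Some a \<in> set xs}) ` ?L" by (rule image_eqI)
  qed
  then have "card {B. B \<subseteq> A \<and> card B \<le> M} \<le> card ?L"
    by (rule surj_card_le[OF finite_lists_length_eq[OF fin]])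
  also have "\<dots> = card ?X ^ M" by (rule card_lists_length_eq[OF fin])
  also have "card ?X = card A + 1" using assms by (simp add: card_image)
  finally show ?thesis .
qed

lemma card_all_edges_le: "card (all_edges n) \<le> n\<^sup>2"
proof -
  have "all_edges n \<subseteq> (\<lambda>(u, v). {u, v}) ` ({..<n} \<times> {..<n})"
    by (auto elim!: all_edgesE)
  then have "card (all_edges n) \<le> card ({..<n} \<times> {..<n})"
    by (rule surj_card_le[rotated]) simp
  then show ?thesis by (simp add: power2_eq_square)
qed

fun message_bit :: "message \<Rightarrow> bool" where
  "message_bit (To_Player i b) = b"
| "message_bit (From_Player i b) = b"

text \<open>With a fixed block length the transcript length tells the coordinator whose turn it is,
  and the length of the own view tells a player which bit comes next.\<close>

definition one_way_protocol :: "nat \<Rightarrow> nat \<Rightarrow> (edges \<Rightarrow> bool list) \<Rightarrow> (bool list \<Rightarrow> edges) \<Rightarrow> protocol" where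
  "one_way_protocol s L enc dec =
    (\<lambda>t. if length t < s * L then Receive (length t div L)
         else Output (\<Union>i<s. dec (map message_bit (take L (drop (i * L) t)))),
     \<lambda>i. if i < s then (\<lambda>x v. enc x ! length v) else (\<lambda>_ _. False))"

lemma length_filter_block:
  assumes "L > 0"
  shows "length (filter (\<lambda>j. j div L = m div L) [0..<m]) = m mod L"
proof -
  define i where "i = m div L"
  have im: "i * L \<le> m" "m - i * L = m mod L"
    unfolding i_def by (rule div_times_less_eq_dividend, rule minus_div_mult_eq_mod)
  have "j div L \<noteq> i" if "j < i * L" for j
    using less_mult_imp_div_less[OF that] by (rule less_imp_neq)
  then have 1: "filter (\<lambda>j. j div L = i) [0..<i * L] = []"
    by (intro filter_False) auto
  have "j div L = i" if "i * L \<le> j" "j < m" for j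
  proof (rule antisym)
    show "j div L \<le> i" unfolding i_def using that by (intro div_le_mono) simp
    have "i * L div L \<le> j div L" using that by (intro div_le_mono)
    then show "i \<le> j div L" using assms by simp
  qed
  then have 2: "filter (\<lambda>j. j div L = i) [i * L..<m] = [i * L..<m]"
    by (intro filter_True) auto
  have "[0..<m] = [0..<i * L] @ [i * L..<m]"
    using upt_add_eq_append[of 0 "i * L" "m - i * L"] im(1) by (metis le_add_diff_inverse zero_le)
  then show ?thesis
    unfolding i_def[symmetric] using 1 2 im(2) by (metis append_Nil filter_append length_upt)
qed

lemma run_one_way_protocol:
  assumes L: "L > 0" and m: "m \<le> s * L"
  shows "run (one_way_protocol s L enc dec) E m
    = map (\<lambda>j. From_Player (j div L) (enc (E (j div L)) ! (j mod L))) [0..<m]"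
  using m
proof (induction m)
  case (Suc m)
  let ?F = "\<lambda>j. From_Player (j div L) (enc (E (j div L)) ! (j mod L))"
  have "m div L < s" using Suc.prems by (simp add: less_mult_imp_div_less)
  moreover have "length (player_view (m div L) (map ?F [0..<m])) = m mod L"
    using length_filter_block[OF L, of m] by (simp add: player_view_def filter_map o_def)
  ultimately have "step (one_way_protocol s L enc dec) E (map ?F [0..<m]) = map ?F [0..<m] @ [?F m]"
    using Suc.prems by (simp add: step_def one_way_protocol_def)
  then show ?case using Suc by simp
qed simp

lemma one_way_protocol_correct:
  fixes dec :: "bool list \<Rightarrow> edges"
  assumes L: "L > 0" and enc: "\<And>i. i < s \<Longrightarrow> length (enc (E i)) = L"
  defines "\<pi> \<equiv> one_way_protocol s L enc dec"
  shows "outputs \<pi> E (\<Union>i<s. dec (enc (E i)))" and "bits_exchanged \<pi> E \<le> enat (s * L)"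
proof -
  let ?F = "\<lambda>j. From_Player (j div L) (enc (E (j div L)) ! (j mod L))"
  have run: "run \<pi> E (s * L) = map ?F [0..<s * L]"
    unfolding \<pi>_def by (rule run_one_way_protocol[OF L order.refl])
  have block: "map message_bit (take L (drop (i * L) (map ?F [0..<s * L]))) = enc (E i)" if i: "i < s" for i
  proof -
    have "i * L + L \<le> s * L" using i by (metis Suc_leI add.commute mult_Suc mult_le_mono1)
    then have len: "length (take L (drop (i * L) (map ?F [0..<s * L]))) = L" by simp
    show ?thesis
    proof (rule nth_equalityI)
      fix j assume "j < length (map message_bit (take L (drop (i * L) (map ?F [0..<s * L]))))"
      then have j: "j < L" using len by simp
      then show "map message_bit (take L (drop (i * L) (map ?F [0..<s * L]))) ! j = enc (E i) ! j"
      proof -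
        have "i * L \<le> s * L" "i * L + j < s * L" using \<open>i * L + L \<le> s * L\<close> j by linarith+
        then show ?thesis using j by (simp add: nth_drop)
      qed
    qed (use enc[OF i] len in simp)
  qed
  have out: "fst \<pi> (run \<pi> E (s * L)) = Output (\<Union>i<s. dec (enc (E i)))"
    unfolding run using block by (simp add: \<pi>_def one_way_protocol_def)
  then show "outputs \<pi> E (\<Union>i<s. dec (enc (E i)))"
    using reachable_run unfolding outputs_def by blast
  have "length t \<le> s * L" if t: "reachable \<pi> E t" for t
  proof (rule ccontr)
    assume "\<not> ?thesis"
    then have "t = run \<pi> E (s * L)"
      using run_stuck[OF out, of "length t"] run_length_reachable[OF t] by simp
    then show False using \<open>\<not> _\<close> length_run_le[of \<pi> E "s * L"] by simp
  qed
  then show "bits_exchanged \<pi> E \<le> enat (s * L)"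
    unfolding bits_exchanged_def by (intro SUP_least) auto
qed

text \<open>Point masses are independent, so a deterministic protocol also fits private coins;
  beyond \<open>s\<close> the strategies must be the default of \<open>Pi_pmf\<close>.\<close>

lemma return_pmf_randomized_protocols:
  assumes "s_player_protocol s \<pi>" "\<And>i. i \<ge> s \<Longrightarrow> snd \<pi> i = (\<lambda>_ _. False)"
  shows "return_pmf \<pi> \<in> randomized_protocols c s"
proof (cases c)
  case Private_Coins
  have "(\<lambda>i. if i \<in> {..<s} then snd \<pi> i else (\<lambda>_ _. False)) = snd \<pi>"
    using assms(2) by (auto simp: fun_eq_iff not_less)
  then have "return_pmf \<pi> = pair_pmf (return_pmf (fst \<pi>)) (Pi_pmf {..<s} (\<lambda>_ _. False) (\<lambda>i. return_pmf (snd \<pi> i)))"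
    by (simp add: Pi_pmf_return_pmf pair_return_pmf1 map_return_pmf)
  then have "\<exists>C P. return_pmf \<pi> = pair_pmf C (Pi_pmf {..<s} (\<lambda>_ _. False) P)" by blast
  then show ?thesis using assms(1) Private_Coins by simp
qed (use assms(1) in simp)

text \<open>Each player sends a subgraph from \<open>exists_maximal_no_detour\<close> of its own
  input. By the Moore bound it has at most \<open>d * n\<close> edges, so \<open>l * (d * n)\<close>
  bits identify it. Every edge of the union belongs to some player, whose substitute walk survives
  in the union of the subgraphs.\<close>

lemma spanner_cost_le:
  assumes k: "k \<ge> 1" and d: "n < d ^ k" "n \<ge> 1" and l: "n\<^sup>2 + 1 \<le> 2 ^ l"
  shows "spanner_cost c (2 * k - 1) s n \<le> enat (s * (l * (d * n)))"
proof -
  define M where "M = d * n"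
  define L where "L = l * M"
  have "d > 0"
  proof (rule ccontr)
    assume "\<not> d > 0"
    then show False using d(1) k by (simp add: power_0_left)
  qed
  moreover have "l > 0" using l d(2) by (cases l) auto
  ultimately have L: "L > 0" using d by (simp add: L_def M_def)
  define S where "S = {H. H \<subseteq> all_edges n \<and> card H \<le> M}"
  define B where "B = {bs :: bool list. set bs \<subseteq> UNIV \<and> length bs = L}"
  have "card S \<le> (card (all_edges n) + 1) ^ M"
    unfolding S_def by (rule card_bounded_subsets_le[OF finite_all_edges])
  also have "\<dots> \<le> (2 ^ l) ^ M"
    using card_all_edges_le[of n] l by (intro power_mono) auto
  also have "\<dots> = card B"
    unfolding B_def by (subst card_lists_length_eq) (simp_all add: L_def power_mult)
  finally have "card S \<le> card B" .
  moreover have "finite S" using finite_all_edges by (simp add: S_def)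
  moreover have "finite B" unfolding B_def by (rule finite_lists_length_eq) simp
  ultimately obtain code where code: "inj_on code S" "code ` S \<subseteq> B"
    using inj_on_iff_card_le by blast
  have "\<exists>H. G \<subseteq> all_edges n \<longrightarrow> H \<subseteq> G \<and> no_detour k H
      \<and> (\<forall>u v. {u, v} \<in> G \<longrightarrow> (\<exists>p. walk H u v p \<and> length p \<le> 2 * k))" for G
    using exists_maximal_no_detour[OF _ k, of G n] by blast
  then obtain h where "\<And>G. G \<subseteq> all_edges n \<longrightarrow> h G \<subseteq> G \<and> no_detour k (h G)
      \<and> (\<forall>u v. {u, v} \<in> G \<longrightarrow> (\<exists>p. walk (h G) u v p \<and> length p \<le> 2 * k))" by metis
  then have h: "h G \<subseteq> G" "no_detour k (h G)" "{u, v} \<in> G \<Longrightarrow> \<exists>p. walk (h G) u v p \<and> length p \<le> 2 * k"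
    if "G \<subseteq> all_edges n" for G u v
    using that by blast+
  have hS: "h G \<in> S" if "G \<subseteq> all_edges n" for G
  proof -
    have "h G \<subseteq> all_edges n" using h(1)[OF that] that by (rule order.trans)
    then show ?thesis using moore_bound[OF _ h(2)[OF that] d(1)] by (simp add: S_def M_def)
  qed
  then have len: "length (code (h G)) = L" if "G \<subseteq> all_edges n" for G
    using code(2) that by (auto simp: B_def)
  define \<pi> where "\<pi> = one_way_protocol s L (\<lambda>G. code (h G)) (inv_into S code)"
  have "worst_case_bits s n (return_pmf \<pi>) \<le> enat (s * L)"
    unfolding worst_case_bits_def
  proof (intro SUP_least)
    fix E \<pi>' assume "E \<in> inputs s n" "\<pi>' \<in> set_pmf (return_pmf \<pi>)"
    moreover from this have "length (code (h (E i))) = L" if "i < s" for i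
      using that by (intro len) (simp add: inputs_def)
    ultimately show "bits_exchanged \<pi>' E \<le> enat (s * L)"
      using one_way_protocol_correct(2)[OF L, of s "\<lambda>G. code (h G)" E "inv_into S code"] by (simp add: \<pi>_def)
  qed
  moreover have "return_pmf \<pi> \<in> randomized_protocols c s"
    by (rule return_pmf_randomized_protocols)
      (auto simp: s_player_protocol_def \<pi>_def one_way_protocol_def less_mult_imp_div_less)
  moreover have "computes_spanner (2 * k - 1) s n (return_pmf \<pi>)"
    unfolding computes_spanner_def
  proof
    fix E assume "E \<in> inputs s n"
    then have E: "E i \<subseteq> all_edges n" if "i < s" for i using that by (simp add: inputs_def)
    have dec: "inv_into S code (code (h (E i))) = h (E i)" if "i < s" for i
      using hS[OF E[OF that]] code(1) by simp
    have "outputs \<pi> E (\<Union>i<s. inv_into S code (code (h (E i))))"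
      unfolding \<pi>_def using L len[OF E] by (rule one_way_protocol_correct(1)[where enc = "\<lambda>G. code (h G)"])
    then have "outputs \<pi> E (\<Union>i<s. h (E i))" using dec by simp
    moreover have "is_spanner (2 * k - 1) n (\<Union>i<s. E i) (\<Union>i<s. h (E i))"
    proof (rule is_spannerI)
      fix u v assume "{u, v} \<in> (\<Union>i<s. E i)"
      then obtain i where i: "i < s" "{u, v} \<in> E i" by auto
      from h(3)[OF E[OF i(1)] i(2)] obtain p where "walk (h (E i)) u v p" "length p \<le> 2 * k" by blast
      moreover have "h (E i) \<subseteq> (\<Union>i<s. h (E i))" using i by auto
      ultimately show "\<exists>p. walk (\<Union>i<s. h (E i)) u v p \<and> length p \<le> Suc (2 * k - 1)"
        using k by (intro exI[of _ p]) (auto intro: walk_mono)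
    next
      show "(\<Union>i<s. h (E i)) \<subseteq> (\<Union>i<s. E i)" using h(1)[OF E] by blast
      show "(\<Union>i<s. E i) \<subseteq> all_edges n" using E by blast
    qed (use k in simp)
    ultimately have "\<pi> \<in> {\<pi>. \<exists>H. outputs \<pi> E H \<and> is_spanner (2 * k - 1) n (\<Union>i<s. E i) H}" by blast
    then show "2 / 3 \<le> measure_pmf.prob (return_pmf \<pi>)
        {\<pi>. \<exists>H. outputs \<pi> E H \<and> is_spanner (2 * k - 1) n (\<Union>i<s. E i) H}"
      by (simp add: measure_return_pmf)
  qed
  ultimately have "spanner_cost c (2 * k - 1) s n \<le> enat (s * L)"
    unfolding spanner_cost_def by (intro INF_lower2[of "return_pmf \<pi>"]) auto
  then show ?thesis by (simp add: L_def M_def)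
qed

lemma soft_O_spanner_cost:
  assumes k: "k \<ge> 1"
  shows "soft_O (\<lambda>n. spanner_cost c (2 * k - 1) (s n) n) (\<lambda>n. real (s n) * real n powr (1 + 1 / real k))"
  unfolding soft_O_def
proof (intro exI conjI)
  \<comment> \<open>The product of the factors in \<open>l \<le> 8 * ln n\<close> and
    \<open>d * n \<le> 3 * n powr (1 + 1 / k)\<close>.\<close>
  show "(24 :: real) > 0" by simp
  show "\<forall>\<^sub>F n in sequentially. ereal_of_enat (spanner_cost c (2 * k - 1) (s n) n)
      \<le> ereal (24 * (real (s n) * real n powr (1 + 1 / real k)) * ln (real n) ^ 1)"
    using eventually_ge_at_top[of 2]
  proof eventually_elim
    case (elim n)
    define x where "x = real n powr (1 / real k)"
    \<comment> \<open>The summand 1 makes \<open>n < d ^ k\<close> strict, and \<open>d\<close>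
      stays below \<open>x + 2 \<le> 3 * x\<close>.\<close>
    define d where "d = nat \<lceil>x\<rceil> + 1"
    define l where "l = nat \<lceil>log 2 (real n ^ 3)\<rceil>"
    have x1: "x \<ge> 1" unfolding x_def using elim by (intro ge_one_powr_ge_zero) auto
    have xk: "x ^ k = real n"
      using elim k by (simp add: x_def powr_realpow[symmetric] powr_powr)
    have xd: "x < real d" "real d \<le> x + 2" using x1 unfolding d_def by linarith+
    then have "x ^ k < real d ^ k" using x1 k by (intro power_strict_mono) auto
    then have nd: "n < d ^ k" unfolding xk by (simp flip: of_nat_power)
    have lnn: "ln (real n) \<ge> ln 2" "ln 2 \<ge> (1/2 :: real)" using elim ln2_ge_two_thirds by auto
    have log: "log 2 (real n ^ 3) = 3 * ln (real n) / ln 2" using elim by (simp add: log_def ln_realpow)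
    have l0: "log 2 (real n ^ 3) \<ge> 0" unfolding log using lnn by simp
    have "n\<^sup>2 + 1 \<le> 2 * n\<^sup>2" using elim by simp
    also have "\<dots> \<le> n ^ 3" using elim by (simp add: power2_eq_square power3_eq_cube)
    finally have "n\<^sup>2 + 1 \<le> n ^ 3" .
    then have "real (n\<^sup>2 + 1) \<le> real n ^ 3" by (metis of_nat_le_iff of_nat_power)
    also have "real n ^ 3 = 2 powr (log 2 (real n ^ 3))" using elim by simp
    also have "\<dots> \<le> 2 powr real l" unfolding l_def by (intro powr_mono) (use l0 in linarith)+
    also have "\<dots> = real (2 ^ l)" by (simp add: powr_realpow)
    finally have nl: "n\<^sup>2 + 1 \<le> 2 ^ l" by (simp only: of_nat_le_iff)
    have "real l \<le> 3 * ln (real n) / ln 2 + 1" using l0 unfolding l_def log by linarith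
    also have "\<dots> \<le> 4 * ln (real n) / ln 2" using lnn by (simp add: field_simps)
    also have "\<dots> \<le> 8 * ln (real n)" using lnn by (simp add: field_simps)
    finally have l8: "real l \<le> 8 * ln (real n)" .
    have dn: "real (d * n) \<le> 3 * real n powr (1 + 1 / real k)"
    proof -
      have "real (d * n) \<le> (3 * x) * real n"
        using xd x1 by (simp add: mult_right_mono)
      also have "\<dots> = 3 * real n powr (1 + 1 / real k)"
        using elim by (simp add: x_def powr_add)
      finally show ?thesis .
    qed
    have "spanner_cost c (2 * k - 1) (s n) n \<le> enat (s n * (l * (d * n)))"
      using elim by (intro spanner_cost_le[OF k nd _ nl]) auto
    then have "ereal_of_enat (spanner_cost c (2 * k - 1) (s n) n) \<le> ereal_of_enat (enat (s n * (l * (d * n))))"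
      by (simp only: ereal_of_enat_le_iff)
    also have "\<dots> = ereal (real (s n) * (real l * real (d * n)))" by simp
    also have "\<dots> \<le> ereal (real (s n) * ((8 * ln (real n)) * (3 * real n powr (1 + 1 / real k))))"
      unfolding ereal_less_eq using l8 dn lnn by (intro mult_left_mono mult_mono) auto
    also have "\<dots> = ereal (24 * (real (s n) * real n powr (1 + 1 / real k)) * ln (real n) ^ 1)"
      by simp
    finally show ?case .
  qed
qed

section \<open>The lower bound\<close>

lemma has_bochner_integral_avg:
  assumes "\<And>A. A \<subseteq> B \<Longrightarrow> has_bochner_integral M (\<lambda>\<omega>. F \<omega> A) (G A)"
  shows "has_bochner_integral M (\<lambda>\<omega>. avg B (F \<omega>)) (avg B G)"
  unfolding avg_def using assms
  by (intro has_bochner_integral_divide has_bochner_integral_sum) auto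

lemma has_bochner_integral_expect:
  assumes "\<And>X. X \<in> PiE I (\<lambda>_. Pow D) \<Longrightarrow> has_bochner_integral M (\<lambda>\<omega>. F \<omega> X) (G X)"
  shows "has_bochner_integral M (\<lambda>\<omega>. expect I D (F \<omega>)) (expect I D G)"
  unfolding expect_def using assms
  by (intro has_bochner_integral_sum has_bochner_integral_mult_right) auto

text \<open>\<open>advantage\<close> is a finite linear combination of values of \<open>P\<close>,
  so it commutes with the expectation over the coins.\<close>

lemma has_bochner_integral_advantage:
  assumes "\<And>X j. has_bochner_integral M (\<lambda>\<omega>. F \<omega> X j) (P X j)"
  shows "has_bochner_integral M (\<lambda>\<omega>. advantage s J i (F \<omega>)) (advantage s J i P)"
  unfolding advantage_def using assms
  by (intro has_bochner_integral_sum has_bochner_integral_avg has_bochner_integral_diff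
      has_bochner_integral_expect)

text \<open>The others have inputs inside \<open>J - insert j y\<close>, so \<open>j\<close> is in
  the union exactly when player \<open>i\<close> holds it, and every averaged difference is at least
  \<open>2 / 3 - 1 / 3\<close>.\<close>

lemma advantage_ge:
  assumes J: "finite J" and i: "i < s"
    and no: "\<And>X j. (\<And>l. l < s \<Longrightarrow> X l \<subseteq> J) \<Longrightarrow> j \<notin> (\<Union>l<s. X l) \<Longrightarrow> P X j \<ge> 2 / 3"
    and yes: "\<And>X j. (\<And>l. l < s \<Longrightarrow> X l \<subseteq> J) \<Longrightarrow> j \<in> (\<Union>l<s. X l) \<Longrightarrow> P X j \<le> 1 / 3"
  shows "card J / 3 \<le> advantage s J i P"
proof -
  have fin: "finite (others s i)" by (simp add: others_def)
  have *: "1 / 3 \<le> expect (others s i) (J - insert j y) (\<lambda>X. P (X(i := x)) j)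
     - expect (others s i) (J - insert j y) (\<lambda>X. P (X(i := insert j x)) j)"
    if j: "j \<in> J" and x: "x \<subseteq> J - {j}" for j x y
  proof -
    have X: "X l \<subseteq> J - insert j y" if "X \<in> PiE (others s i) (\<lambda>_. Pow (J - insert j y))" "l < s" "l \<noteq> i" for X l
      using that by (auto simp: others_def PiE_def Pi_def)
    have "expect (others s i) (J - insert j y) (\<lambda>_. 2 / 3)
        \<le> expect (others s i) (J - insert j y) (\<lambda>X. P (X(i := x)) j)"
    proof (intro expect_mono no)
      fix X assume mem: "X \<in> PiE (others s i) (\<lambda>_. Pow (J - insert j y))"
      show "(X(i := x)) l \<subseteq> J" if "l < s" for l using X[OF mem that] x by (cases "l = i") auto
      have "j \<notin> (X(i := x)) l" if "l < s" for l using X[OF mem that] x by (cases "l = i") auto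
      then show "j \<notin> (\<Union>l<s. (X(i := x)) l)" by blast
    qed
    moreover have "expect (others s i) (J - insert j y) (\<lambda>X. P (X(i := insert j x)) j)
        \<le> expect (others s i) (J - insert j y) (\<lambda>_. 1 / 3)"
    proof (intro expect_mono yes)
      fix X assume mem: "X \<in> PiE (others s i) (\<lambda>_. Pow (J - insert j y))"
      show "(X(i := insert j x)) l \<subseteq> J" if "l < s" for l using X[OF mem that] x j by (cases "l = i") auto
      show "j \<in> (\<Union>l<s. (X(i := insert j x)) l)" using i by (intro UN_I[of i]) auto
    qed
    ultimately show ?thesis using J fin by (simp add: expect_const)
  qed
  have "card J / 3 = (\<Sum>j\<in>J. avg (J - {j}) (\<lambda>A. avg A (\<lambda>x. avg (J - {j} - A) (\<lambda>y. 1 / 3))))"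
  proof -
    have "avg (J - {j}) (\<lambda>A. avg A (\<lambda>x. avg (J - {j} - A) (\<lambda>y. 1 / 3))) = avg (J - {j}) (\<lambda>A. 1 / 3)" for j
      using J finite_subset by (intro avg_cong) (fastforce simp: avg_const)
    then have eq: "avg (J - {j}) (\<lambda>A. avg A (\<lambda>x. avg (J - {j} - A) (\<lambda>y. 1 / 3))) = 1 / 3" for j
      using J by (simp only: avg_const finite_Diff)
    show ?thesis unfolding eq by simp
  qed
  also have "\<dots> \<le> advantage s J i P"
    unfolding advantage_def by (intro sum_mono avg_mono *) auto
  finally show ?thesis .
qed

text \<open>Correctness forces an advantage of \<open>card J / 3\<close> for every player, whereas
  averaging \<open>sum_advantage_le\<close> over the coins allows only about
  \<open>card J / 6\<close> per player without communication. The gap is paid in bits.\<close>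

lemma worst_case_bits_lower_bound:
  assumes J: "J \<subseteq> all_edges n" and girth: "enat (2 * k) < girth J"
    and R: "computes_spanner (2 * k - 1) s n R" and T: "worst_case_bits s n R \<le> enat T"
  shows "s * (card J / 6 - 576) \<le> 1728 * real T"
proof -
  have finJ: "finite J" using J finite_all_edges finite_subset by blast
  define P where "P X j = measure_pmf.prob R {\<pi>. j \<notin> outcome \<pi> T X}" for X j
  have prob: "2 / 3 \<le> measure_pmf.prob R {\<pi>. outcome \<pi> T X = (\<Union>l<s. X l)}"
    if X: "\<And>l. l < s \<Longrightarrow> X l \<subseteq> J" for X
  proof -
    have inp: "X \<in> inputs s n" using X J by (auto simp: inputs_def)
    have "2 / 3 \<le> measure_pmf.prob R {\<pi>. \<exists>H. outputs \<pi> X H \<and> is_spanner (2 * k - 1) n (\<Union>l<s. X l) H}"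
      using R inp by (simp add: computes_spanner_def)
    also have "\<dots> \<le> measure_pmf.prob R {\<pi>. outcome \<pi> T X = (\<Union>l<s. X l)}"
    \<comment> \<open>The bound \<open>T\<close> holds only on the support of \<open>R\<close>, so
      the inclusion of events is only almost sure.\<close>
    proof (rule measure_pmf.finite_measure_mono_AE)
      show "AE \<pi> in measure_pmf R. \<pi> \<in> {\<pi>. \<exists>H. outputs \<pi> X H \<and> is_spanner (2 * k - 1) n (\<Union>l<s. X l) H}
          \<longrightarrow> \<pi> \<in> {\<pi>. outcome \<pi> T X = (\<Union>l<s. X l)}"
        unfolding AE_measure_pmf_iff
      proof (intro ballI impI)
        fix \<pi> assume \<pi>: "\<pi> \<in> set_pmf R"
          and "\<pi> \<in> {\<pi>. \<exists>H. outputs \<pi> X H \<and> is_spanner (2 * k - 1) n (\<Union>l<s. X l) H}"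
        then obtain H where H: "outputs \<pi> X H" "is_spanner (2 * k - 1) n (\<Union>l<s. X l) H" by blast
        have "bits_exchanged \<pi> X \<le> worst_case_bits s n R"
          unfolding worst_case_bits_def using inp \<pi> by (intro SUP_upper2[OF inp] SUP_upper)
        then have "outcome \<pi> T X = H"
          using outputs_iff_outcome[of \<pi> X T H] T H(1) by (metis order.trans)
        moreover have "H = (\<Union>l<s. X l)"
          using X by (intro spanner_of_high_girth[OF _ J girth H(2)]) blast
        ultimately show "\<pi> \<in> {\<pi>. outcome \<pi> T X = (\<Union>l<s. X l)}" by simp
      qed
    qed simp
    finally show ?thesis .
  qed
  have adv: "card J / 3 \<le> advantage s J i P" if "i < s" for i
  proof (rule advantage_ge[OF finJ that])
    fix X :: "nat \<Rightarrow> edges" and j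
    assume X: "\<And>l. l < s \<Longrightarrow> X l \<subseteq> J"
    show "2 / 3 \<le> P X j" if "j \<notin> (\<Union>l<s. X l)"
    proof -
      have "2 / 3 \<le> measure_pmf.prob R {\<pi>. outcome \<pi> T X = (\<Union>l<s. X l)}" using X by (rule prob)
      also have "\<dots> \<le> P X j"
        unfolding P_def using that by (intro measure_pmf.finite_measure_mono) auto
      finally show ?thesis .
    qed
    show "P X j \<le> 1 / 3" if "j \<in> (\<Union>l<s. X l)"
    proof -
      have "P X j \<le> measure_pmf.prob R (UNIV - {\<pi>. outcome \<pi> T X = (\<Union>l<s. X l)})"
        unfolding P_def using that by (intro measure_pmf.finite_measure_mono) auto
      also have "\<dots> = 1 - measure_pmf.prob R {\<pi>. outcome \<pi> T X = (\<Union>l<s. X l)}"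
        using measure_pmf.prob_compl[of "{\<pi>. outcome \<pi> T X = (\<Union>l<s. X l)}" R] by simp
      finally show ?thesis using prob[of X, OF X] by linarith
    qed
  qed
  define F where "F \<pi> X j = (of_bool (j \<notin> outcome \<pi> T X) :: real)" for \<pi> X j
  have "has_bochner_integral R (\<lambda>\<pi>. F \<pi> X j) (P X j)" for X j
  proof -
    have "has_bochner_integral R (indicator {\<pi>. j \<notin> outcome \<pi> T X} :: _ \<Rightarrow> real) (P X j)"
      unfolding P_def by (intro has_bochner_integral_real_indicator) (auto simp: measure_pmf.emeasure_eq_measure)
    moreover have "F \<pi> X j = indicator {\<pi>. j \<notin> outcome \<pi> T X} \<pi>" for \<pi>
      by (simp add: F_def indicator_def)
    ultimately show ?thesis by simp
  qed
  then have int: "has_bochner_integral R (\<lambda>\<pi>. \<Sum>i<s. advantage s J i (F \<pi>)) (\<Sum>i<s. advantage s J i P)"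
    by (intro has_bochner_integral_sum has_bochner_integral_advantage)
  have "s * (card J / 3) = (\<Sum>i<s. card J / 3)" by simp
  also have "\<dots> \<le> (\<Sum>i<s. advantage s J i P)" using adv by (intro sum_mono) auto
  also have "\<dots> = measure_pmf.expectation R (\<lambda>\<pi>. \<Sum>i<s. advantage s J i (F \<pi>))"
    using has_bochner_integral_integral_eq[OF int] by simp
  also have "\<dots> \<le> s * (card J / 6 + 576) + 1728 * real T"
  proof (rule measure_pmf.integral_le_const)
    show "integrable R (\<lambda>\<pi>. \<Sum>i<s. advantage s J i (F \<pi>))"
      using int by (simp add: has_bochner_integral_iff)
    show "AE \<pi> in measure_pmf R. (\<Sum>i<s. advantage s J i (F \<pi>)) \<le> s * (card J / 6 + 576) + 1728 * real T"
      unfolding F_def using sum_advantage_le[OF finJ] by (intro AE_I2) blast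
  qed
  finally show ?thesis by (simp add: algebra_simps)
qed

lemma spanner_cost_lower_bound:
  assumes "J \<subseteq> all_edges n" "enat (2 * k) < girth J" "card J \<ge> 6912"
  shows "ereal (real s * real (card J) / 20736) \<le> ereal_of_enat (spanner_cost c (2 * k - 1) s n)"
proof -
  define N where "N = nat \<lceil>real s * real (card J) / 20736\<rceil>"
  have "enat N \<le> worst_case_bits s n R" if R: "computes_spanner (2 * k - 1) s n R" for R
  proof (cases "worst_case_bits s n R")
    case (enat T)
    \<comment> \<open>\<open>6912 = 12 * 576\<close> makes 576 at most \<open>card J / 12\<close>;
      then \<open>20736 = 12 * 1728\<close>.\<close>
    have "s * (card J / 12) \<le> s * (card J / 6 - 576)"
      using assms(3) by (intro mult_left_mono) auto
    also have "\<dots> \<le> 1728 * real T"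
      using worst_case_bits_lower_bound[OF assms(1,2) R] enat by simp
    finally have "real s * real (card J) / 20736 \<le> real T" by simp
    then have "N \<le> T" unfolding N_def by linarith
    then show ?thesis using enat by simp
  qed simp
  then have "enat N \<le> spanner_cost c (2 * k - 1) s n"
    unfolding spanner_cost_def by (intro INF_greatest) auto
  then have "ereal_of_enat (enat N) \<le> ereal_of_enat (spanner_cost c (2 * k - 1) s n)"
    by (simp only: ereal_of_enat_le_iff)
  moreover have "real s * real (card J) / 20736 \<le> real N" unfolding N_def by linarith
  then have "ereal (real s * real (card J) / 20736) \<le> ereal_of_enat (enat N)" by simp
  ultimately show ?thesis by (rule order.trans[rotated])
qed

lemma soft_Omega_spanner_cost:
  assumes k: "k \<ge> 1" and erdos_girth_conjecture
  shows "soft_Omega (\<lambda>n. spanner_cost c (2 * k - 1) (s n) n) (\<lambda>n. real (s n) * real n powr (1 + 1 / real k))"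
proof -
  obtain c\<^sub>0 where c0: "c\<^sub>0 > 0"
    and ev: "\<forall>\<^sub>F n in sequentially. \<exists>E \<subseteq> all_edges n.
        girth E = enat (2 * k + 2) \<and> real (card E) \<ge> c\<^sub>0 * real n powr (1 + 1 / real k)"
    using assms unfolding erdos_girth_conjecture_def by blast
  \<comment> \<open>No logarithm is lost, hence the exponent 0. The threshold on \<open>n\<close>
    below ensures \<open>card E \<ge> 6912\<close>, because the power of \<open>n\<close> is at
    least \<open>n\<close>.\<close>
  have "\<forall>\<^sub>F n in sequentially. ereal (c\<^sub>0 / 20736 * (real (s n) * real n powr (1 + 1 / real k)) / ln (real n) ^ 0)
      \<le> ereal_of_enat (spanner_cost c (2 * k - 1) (s n) n)"
    using ev eventually_ge_at_top[of "nat \<lceil>6912 / c\<^sub>0\<rceil> + 1"]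
  proof eventually_elim
    case (elim n)
    then obtain E where E: "E \<subseteq> all_edges n" "girth E = enat (2 * k + 2)"
      "c\<^sub>0 * real n powr (1 + 1 / real k) \<le> real (card E)" by blast
    have "6912 / c\<^sub>0 \<le> real n" using elim(2) by linarith
    moreover have "n \<ge> 1" using elim(2) by simp
    then have "real n powr 1 \<le> real n powr (1 + 1 / real k)" by (intro powr_mono) auto
    ultimately have "6912 / c\<^sub>0 \<le> real n powr (1 + 1 / real k)" using \<open>n \<ge> 1\<close> by simp
    then have "6912 \<le> card E" using E(3) c0 by (simp add: field_simps)
    have "c\<^sub>0 / 20736 * (real (s n) * real n powr (1 + 1 / real k)) / ln (real n) ^ 0
        = real (s n) * (c\<^sub>0 * real n powr (1 + 1 / real k)) / 20736" by simp
    also have "\<dots> \<le> real (s n) * card E / 20736"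
      using E(3) by (intro divide_right_mono mult_left_mono) auto
    finally have "ereal (c\<^sub>0 / 20736 * (real (s n) * real n powr (1 + 1 / real k)) / ln (real n) ^ 0)
        \<le> ereal (real (s n) * card E / 20736)" by (simp only: ereal_less_eq)
    also have "\<dots> \<le> ereal_of_enat (spanner_cost c (2 * k - 1) (s n) n)"
      using E(2) \<open>6912 \<le> card E\<close> by (intro spanner_cost_lower_bound[OF E(1)]) simp_all
    finally show ?case .
  qed
  then show ?thesis unfolding soft_Omega_def using c0 by (intro exI[of _ "c\<^sub>0 / 20736"] exI[of _ 0] conjI) simp_all
qed

theorem theorem4p3:
  fixes k :: nat and s :: "nat \<Rightarrow> nat" and c :: coins
  assumes "k \<ge> 1"
    and "\<And>n. s n \<ge> 1"
    and "(\<lambda>n. real (s n)) \<in> o(\<lambda>n. real n)"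
  shows "soft_O (\<lambda>n. spanner_cost c (2 * k - 1) (s n) n)
           (\<lambda>n. real (s n) * real n powr (1 + 1 / real k)) \<and>
         (erdos_girth_conjecture \<longrightarrow>
         soft_Theta (\<lambda>n. spanner_cost c (2 * k - 1) (s n) n)
           (\<lambda>n. real (s n) * real n powr (1 + 1 / real k)))"
  unfolding soft_Theta_def
  using soft_O_spanner_cost[OF assms(1)] soft_Omega_spanner_cost[OF assms(1)] by blast

end
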